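(* Assume that $\varphi,g\in\mathcal{H}ol(\mathbb{C})$, $\alpha>0$ and $0<q\le\infty$. Then $K_{\varphi,g}:\mathcal{F}_\alpha^\infty(\mathbb{C})\to\mathcal{F}_\alpha^q(\mathbb{C})$ is a bounded operator if and only if $$\frac{1+|\varphi(z)|}{1+|z|}\,|g(\varphi(z))\,\varphi'(z)|\,e^{\frac{\alpha}{2}(|\varphi(z)|^2-|z|^2)}\in L^q(\mathbb{C},\nu_1).$$
   Context: $\mathcal{H}ol(\mathbb{C})$ is the space of entire functions on $\mathbb{C}$ and $\nu_1$ is Lebesgue (area) measure on $\mathbb{C}$. For $0<q<\infty$, the Fock space $\mathcal{F}_\alpha^q(\mathbb{C})$ consists of those $f\in\mathcal{H}ol(\mathbb{C})$ with $\|f\|_{\mathcal{F}_\alpha^q}^q=\frac{\alpha q}{2\pi}\int_{\mathbb{C}}|f(z)|^q e^{-\frac{\alpha q}{2}|z|^2}\,d\nu_1(z)<\infty$; $\mathcal{F}_\alpha^\infty(\mathbb{C})$ consists of those $f\in\mathcal{H}ol(\mathbb{C})$ with $\|f\|_{\mathcal{F}_\alpha^\infty}=\sup_{z\in\mathbb{C}}|f(z)|e^{-\frac{\alpha}{2}|z|^2}<\infty$. The operator $K_{\varphi,g}$ is defined by $K_{\varphi,g}f(z)=\int_0^{\varphi(z)}f'(\xi)\,g(\xi)\,d\xi$, $f\in\mathcal{H}ol(\mathbb{C})$, $z\in\mathbb{C}$. *)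

theory Defs
  imports "HOL-Complex_Analysis.Complex_Analysis"
begin

text \<open>
  Exponents range over \<open>(0, \<infinity>]\<close> and are rendered as elements of \<^typ>\<open>ennreal\<close>; the definitions are
  meant for \<open>q > 0\<close> only. The measure \<open>\<nu>\<^sub>1\<close> is \<^term>\<open>lebesgue :: complex measure\<close>, i.e. area measure
  without a normalising factor.
\<close>

definition fock_space :: "real \<Rightarrow> ennreal \<Rightarrow> (complex \<Rightarrow> complex) set" where
  "fock_space \<alpha> q = {f. f holomorphic_on UNIV \<and>
     (if q = \<infinity>
      then bdd_above (range (\<lambda>z. cmod (f z) * exp (- (\<alpha> / 2) * (cmod z)\<^sup>2)))
      else integrable lebesgue
             (\<lambda>z. cmod (f z) powr enn2real q * exp (- (\<alpha> * enn2real q / 2) * (cmod z)\<^sup>2)))}"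

text \<open>For \<open>q < 1\<close> this is only a quasi-norm. It is meaningful only on \<^term>\<open>fock_space \<alpha> q\<close>; outside,
  the integral and the supremum take junk values.\<close>

definition fock_norm :: "real \<Rightarrow> ennreal \<Rightarrow> (complex \<Rightarrow> complex) \<Rightarrow> real" where
  "fock_norm \<alpha> q f =
     (if q = \<infinity>
      then (SUP z. cmod (f z) * exp (- (\<alpha> / 2) * (cmod z)\<^sup>2))
      else (\<alpha> * enn2real q / (2 * pi) *
             (LINT z|lebesgue.
                cmod (f z) powr enn2real q * exp (- (\<alpha> * enn2real q / 2) * (cmod z)\<^sup>2)))
           powr (1 / enn2real q))"

text \<open>The integrand is entire, so the integral does not depend on the path from \<open>0\<close> to \<open>\<phi> z\<close>; the
  segment is used.\<close>

definition K_op ::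
  "(complex \<Rightarrow> complex) \<Rightarrow> (complex \<Rightarrow> complex) \<Rightarrow> (complex \<Rightarrow> complex) \<Rightarrow> complex \<Rightarrow> complex" where
  "K_op \<phi> g f = (\<lambda>z. contour_integral (linepath 0 (\<phi> z)) (\<lambda>\<xi>. deriv f \<xi> * g \<xi>))"

definition bounded_fock_operator ::
  "real \<Rightarrow> ennreal \<Rightarrow> ennreal \<Rightarrow> ((complex \<Rightarrow> complex) \<Rightarrow> complex \<Rightarrow> complex) \<Rightarrow> bool" where
  "bounded_fock_operator \<alpha> p q T \<longleftrightarrow>
     (\<forall>f\<in>fock_space \<alpha> p. T f \<in> fock_space \<alpha> q) \<and>
     (\<forall>f\<in>fock_space \<alpha> p. \<forall>h\<in>fock_space \<alpha> p. \<forall>a b.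
        T (\<lambda>z. a * f z + b * h z) = (\<lambda>z. a * T f z + b * T h z)) \<and>
     (\<exists>C. \<forall>f\<in>fock_space \<alpha> p. fock_norm \<alpha> q (T f) \<le> C * fock_norm \<alpha> p f)"

definition Lq :: "ennreal \<Rightarrow> 'a measure \<Rightarrow> ('a \<Rightarrow> real) set" where
  "Lq q M = {h. h \<in> borel_measurable M \<and>
     (if q = \<infinity>
      then \<exists>C. AE x in M. \<bar>h x\<bar> \<le> C
      else integrable M (\<lambda>x. \<bar>h x\<bar> powr enn2real q))}"

end

theory Submission
  imports Defs "HOL-Real_Asymp.Real_Asymp"
begin

text \<open>
  The function \<open>F = K_op \<phi> g f\<close> has derivative \<open>f' (\<phi> z) g (\<phi> z) \<phi>' z\<close>, and \<open>F\<close> lies in the Fock space with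
  exponent \<open>q\<close> if and only if \<open>|F' z| / (1 + |z|) exp (- \<alpha> |z|\<^sup>2 / 2)\<close> lies in \<open>L\<^sup>q\<close>, with equivalence of
  (quasi-)norms once \<open>|F 0|\<close> is added. Sufficiency follows from the pointwise bound
  \<open>|f' w| \<le> C ||f|| (1 + |w|) exp (\<alpha> |w|\<^sup>2 / 2)\<close>. For necessity this bound is reversed by a finite set of
  test functions of the space with exponent \<open>\<infinity>\<close>: at every point \<open>w\<close> one of them satisfies
  \<open>|f' w| \<ge> c (1 + |w|) exp (\<alpha> |w|\<^sup>2 / 2)\<close>.

  For \<open>q < \<infinity>\<close> the norm equivalence rests on sub-mean value estimates over discs of radius comparable to
  \<open>1 / (1 + |z|)\<close>, on which the Gaussian weight is nearly constant. To bound \<open>F\<close> by \<open>F'\<close>, compare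
  \<open>F z\<close> with its value at a point slightly closer to the origin; the weight gains a small factor there, and
  the resulting term is absorbed.
\<close>

section \<open>Sub-mean value estimates\<close>

text \<open>Normalised reproducing kernels reach the maximal growth at one point each, so they would
  form an infinite family, and for \<open>q < \<infinity>\<close> it would remain to integrate over
  its members. With finitely many test functions the one chosen at a point is dominated by the sum
  over all of them, and a finite sum of finite integrals is finite. One function cannot suffice: f'
  would have no zeros, so log |f' w| would be harmonic and could not grow in the mean like |w|^2. In
  the estimate of F by F' the obstacle is that absorbing a term requires the integral of F to be
  finite, which is what has to be shown. The absorption is therefore done over |z| < N with a bound
  that does not depend on N. The same truncated integral must reappear on the right, so no disc in
  use may leave |w| < N; this is why the comparison point lies closer to the origin by at least the
  radius of the disc around it.\<close>

text \<open>The maximum point \<open>z0\<close> of \<open>(R - |z - c|) |F z| powr (q / 2)\<close> serves all \<open>q > 0\<close> at once, including \<open>q < 1\<close>: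
  near \<open>z0\<close> the values of \<open>|F|\<close> are at most a constant times \<open>|F z0|\<close>, so by Cauchy's inequality
  \<open>|F|\<close> stays above \<open>|F z0| / 2\<close> on a disc of comparable radius.\<close>

lemma entire_submean:
  fixes q :: real
  assumes "q > 0"
  obtains C where "C > 0"
    and "\<And>F c R. F holomorphic_on UNIV \<Longrightarrow> R > 0 \<Longrightarrow>
      ennreal (R\<^sup>2 * cmod (F c) powr q)
        \<le> ennreal C * (\<integral>\<^sup>+w. ennreal (cmod (F w) powr q) * indicator (ball c R) w \<partial>lborel)"
proof -
  \<comment> \<open>Within \<open>d / 2\<close> of \<open>z0\<close> the factor R - |w - c| is still
    at least \<open>d / 2\<close>, so maximality gives |F w| powr (q / 2) at most twice the value at
    \<open>z0\<close>. Taking the power \<open>2 / q\<close> turns that 2 into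
    \<open>A\<close>.\<close>
  define A :: real where "A = 2 powr (2 / q)"
  have A1: "A \<ge> 1" using assms by (simp add: A_def ge_one_powr_ge_zero)
  \<comment> \<open>The factors undo, in turn, the loss from \<open>m\<close> to
    \<open>m / 2\<close>, the ratio \<open>8 * A\<close> of \<open>d\<close> to the radius
    \<open>r\<close>, and the \<open>pi\<close> in the area of \<open>ball z0 r\<close>.\<close>
  define C where "C = 2 powr q * 64 * A\<^sup>2 / pi"
  have C0: "C > 0" using A1 by (simp add: C_def)
  have "ennreal (R\<^sup>2 * cmod (F c) powr q)
        \<le> ennreal C * (\<integral>\<^sup>+w. ennreal (cmod (F w) powr q) * indicator (ball c R) w \<partial>lborel)"
    if hol: "F holomorphic_on UNIV" and R: "R > 0" for F :: "complex \<Rightarrow> complex" and c R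
  proof (cases "F c = 0")
    case True
    then show ?thesis using assms by simp
  next
    case False
    have cont: "continuous_on S F" for S
      using holomorphic_on_imp_continuous_on[OF hol] continuous_on_subset by blast
    define u where "u = (\<lambda>z. (R - dist c z) * cmod (F z) powr (q / 2))"
    have "continuous_on (cball c R) u"
      unfolding u_def using assms
      by (intro continuous_intros continuous_on_powr' cont) auto
    then obtain z0 where z0: "z0 \<in> cball c R" and max: "\<And>w. w \<in> cball c R \<Longrightarrow> u w \<le> u z0"
      using continuous_attains_sup[of "cball c R" u] R by auto
    define d where "d = R - dist c z0"
    define m where "m = cmod (F z0)"
    have uc: "R * cmod (F c) powr (q / 2) \<le> d * m powr (q / 2)"
      using max[of c] R by (simp add: u_def d_def m_def)
    have pos: "R * cmod (F c) powr (q / 2) > 0" using R False by simp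
    have d0: "d \<ge> 0" using z0 by (simp add: d_def)
    have m0: "m \<ge> 0" by (simp add: m_def)
    have dpos: "d > 0" using uc pos d0 by (cases "d = 0") auto
    have mpos: "m > 0" using uc pos m0 by (cases "m = 0") auto
    have up: "cmod (F w) \<le> A * m" if w: "w \<in> cball z0 (d / 2)" for w
    proof -
      have tri: "dist c w \<le> dist c z0 + dist z0 w" by (rule dist_triangle)
      have dw: "d / 2 \<le> R - dist c w" using w tri by (simp add: d_def)
      have "w \<in> cball c R" using dw dpos by simp
      from max[OF this] have "(R - dist c w) * cmod (F w) powr (q / 2) \<le> d * m powr (q / 2)"
        by (simp add: u_def d_def m_def)
      moreover have "d / 2 * cmod (F w) powr (q / 2) \<le> (R - dist c w) * cmod (F w) powr (q / 2)"
        using dw by (intro mult_right_mono) auto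
      ultimately have "d * (cmod (F w) powr (q / 2)) \<le> d * (2 * m powr (q / 2))" by simp
      then have "cmod (F w) powr (q / 2) \<le> 2 * m powr (q / 2)" using dpos by simp
      then have "(cmod (F w) powr (q / 2)) powr (2 / q) \<le> (2 * m powr (q / 2)) powr (2 / q)"
        using assms by (intro powr_mono2) auto
      then show ?thesis using assms mpos by (simp add: powr_powr powr_mult A_def)
    qed
    have der: "cmod (deriv F w) \<le> 4 * A * m / d" if w: "w \<in> ball z0 (d / 4)" for w
    proof -
      have "norm ((deriv ^^ 1) F w) \<le> fact 1 * (A * m) / (d / 4) ^ 1"
      proof (rule Cauchy_inequality)
        show "F holomorphic_on ball w (d / 4)" using hol holomorphic_on_subset by blast
        show "continuous_on (cball w (d / 4)) F" by (rule cont)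
        fix x assume "cmod (w - x) = d / 4"
        then have "dist z0 x \<le> d / 4 + d / 4"
          using w dist_triangle[of z0 x w] by (simp add: dist_norm)
        then show "cmod (F x) \<le> A * m" by (intro up) simp
      qed (use dpos in auto)
      then show ?thesis by (simp add: mult_ac)
    qed
    \<comment> \<open>Chosen so that the derivative bound \<open>4 * A * m / d\<close> times
      \<open>r\<close> is exactly \<open>m / 2\<close>.\<close>
    define r where "r = d / (8 * A)"
    have r0: "r > 0" using dpos A1 by (simp add: r_def)
    have r8: "r \<le> d / 8" using dpos A1 by (simp add: r_def divide_le_eq)
    have low: "m / 2 \<le> cmod (F w)" if w: "w \<in> ball z0 r" for w
    proof -
      have "cmod (F w - F z0) \<le> (4 * A * m / d) * cmod (w - z0)"
      proof (rule field_differentiable_bound[of "ball z0 (d / 4)" F "deriv F"])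
        fix z
        show "(F has_field_derivative deriv F z) (at z within ball z0 (d / 4))"
          using hol holomorphic_derivI has_field_derivative_at_within open_UNIV by blast
      qed (use w r8 dpos der in auto)
      also have "\<dots> \<le> (4 * A * m / d) * r"
        using w A1 mpos dpos by (intro mult_left_mono) (auto simp: dist_norm norm_minus_commute)
      also have "\<dots> = m / 2" using A1 dpos by (simp add: r_def field_simps)
      finally have "cmod (F z0) - cmod (F w) \<le> m / 2"
        by (metis norm_minus_commute norm_triangle_ineq2 order_trans)
      then show ?thesis by (simp add: m_def)
    qed
    have sub: "ball z0 r \<subseteq> ball c R"
    proof
      fix w assume "w \<in> ball z0 r"
      then show "w \<in> ball c R"
        using dist_triangle[of c w z0] r8 dpos by (simp add: d_def)
    qed
    \<comment> \<open>Squaring explains the exponent \<open>q / 2\<close> in \<open>u\<close>: it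
      produces the power q of |F| together with the square of \<open>d\<close>, which up to a
      constant is the area of the disc where |F| is at least \<open>m / 2\<close>.\<close>
    have "(R * cmod (F c) powr (q / 2))\<^sup>2 \<le> (d * m powr (q / 2))\<^sup>2"
      using uc pos by (intro power_mono) auto
    moreover have "(x powr (q / 2))\<^sup>2 = x powr q" for x :: real
      by (simp add: power2_eq_square flip: powr_add)
    ultimately have "R\<^sup>2 * cmod (F c) powr q \<le> d\<^sup>2 * m powr q"
      by (simp add: power_mult_distrib)
    also have "\<dots> = C * ((m / 2) powr q * (pi * r\<^sup>2))"
      using A1 mpos by (simp add: C_def r_def powr_divide field_simps)
    finally have "ennreal (R\<^sup>2 * cmod (F c) powr q) \<le> ennreal (C * ((m / 2) powr q * (pi * r\<^sup>2)))"
      by (rule ennreal_leI)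
    also have "\<dots> = ennreal C * (ennreal ((m / 2) powr q) * emeasure lborel (ball z0 r))"
      using C0 r0 by (simp add: emeasure_ball unit_ball_vol_2 ennreal_mult' ennreal_mult)
    also have "ennreal ((m / 2) powr q) * emeasure lborel (ball z0 r)
        = (\<integral>\<^sup>+w. ennreal ((m / 2) powr q) * indicator (ball z0 r) w \<partial>lborel)"
      by (simp add: nn_integral_cmult_indicator)
    also have "\<dots> \<le> (\<integral>\<^sup>+w. ennreal (cmod (F w) powr q) * indicator (ball c R) w \<partial>lborel)"
    proof (rule nn_integral_mono)
      fix w
      show "ennreal ((m / 2) powr q) * indicator (ball z0 r) w
          \<le> ennreal (cmod (F w) powr q) * indicator (ball c R) w"
        using low[of w] sub assms mpos
        by (auto simp: indicator_def intro!: ennreal_leI powr_mono2)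
    qed
    finally show ?thesis by (simp add: mult_left_mono)
  qed
  with C0 that show thesis by blast
qed

section \<open>Averages over discs whose radius shrinks like 1 / (1 + |z|)\<close>

lemma nn_integral_cmult_ball:
  fixes h :: "complex \<Rightarrow> ennreal"
  assumes [measurable]: "h \<in> borel_measurable borel"
  shows "(\<integral>\<^sup>+w. b * (h w * indicator (ball a r) w) \<partial>lborel)
    = b * (\<integral>\<^sup>+w. h w * indicator (ball a r) w \<partial>lborel)"
proof -
  have [measurable]: "ball a r \<in> sets borel" by simp
  show ?thesis by (rule nn_integral_cmult) measurable
qed

text \<open>Membership in the moving disc, rewritten without division as
  \<open>dist z w * (1 + cmod z) < R\<close>, is visibly a measurable condition on the pair (z,
  w).\<close>

lemma borel_measurable_moving_disc:
  fixes h :: "complex \<Rightarrow> ennreal"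
  assumes [measurable]: "h \<in> borel_measurable borel"
  shows "(\<lambda>z. ennreal ((1 + cmod z)\<^sup>2) *
      (\<integral>\<^sup>+w. h w * indicator (ball z (R / (1 + cmod z))) w \<partial>lborel)) \<in> borel_measurable lborel"
proof -
  have "indicator (ball z (R / (1 + cmod z))) w
      = (if dist z w * (1 + cmod z) < R then 1 else 0 :: ennreal)" for z w
    by (simp add: indicator_def pos_less_divide_eq add_pos_nonneg)
  then show ?thesis by simp
qed

text \<open>Exchange the integrals. For fixed w, the centres z whose disc contains w satisfy |z - w|
  < R, so 1 + |z| and 1 + |w| agree up to the factor 1 + R. Hence these z fill at most a disc about
  w of radius R (1 + R) / (1 + |w|), and its area times the largest weight no longer depends on
  w.\<close>

lemma nn_integral_moving_disc_le:
  fixes h :: "complex \<Rightarrow> ennreal"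
  assumes [measurable]: "h \<in> borel_measurable borel" and R: "R > 0"
  shows "(\<integral>\<^sup>+z. ennreal ((1 + cmod z)\<^sup>2) *
            (\<integral>\<^sup>+w. h w * indicator (ball z (R / (1 + cmod z))) w \<partial>lborel) \<partial>lborel)
         \<le> ennreal (pi * R\<^sup>2 * (1 + R) ^ 4) * (\<integral>\<^sup>+w. h w \<partial>lborel)"
proof -
  define k :: "complex \<Rightarrow> complex \<Rightarrow> ennreal" where
    "k = (\<lambda>z w. ennreal ((1 + cmod z)\<^sup>2) * (if dist z w * (1 + cmod z) < R then h w else 0))"
  have ball: "w \<in> ball z (R / (1 + cmod z)) \<longleftrightarrow> dist z w * (1 + cmod z) < R" for z w :: complex
    by (simp add: pos_less_divide_eq add_pos_nonneg)
  have inner: "(\<integral>\<^sup>+z. k z w \<partial>lborel) \<le> ennreal (pi * R\<^sup>2 * (1 + R) ^ 4) * h w" for w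
  proof -
    have "(\<integral>\<^sup>+z. k z w \<partial>lborel) \<le>
        (\<integral>\<^sup>+z. (ennreal ((1 + R)\<^sup>2 * (1 + cmod w)\<^sup>2) * h w) * indicator (ball w (R * (1 + R) / (1 + cmod w))) z \<partial>lborel)"
    proof (rule nn_integral_mono)
      fix z :: complex
      show "k z w \<le> (ennreal ((1 + R)\<^sup>2 * (1 + cmod w)\<^sup>2) * h w) * indicator (ball w (R * (1 + R) / (1 + cmod w))) z"
      proof (cases "dist z w * (1 + cmod z) < R")
        case True
        have zw: "dist z w \<le> R"
          using True mult_left_mono[of 1 "1 + cmod z" "dist z w"] by simp
        have a: "1 + cmod z \<le> (1 + R) * (1 + cmod w)"
        proof -
          have "1 + cmod z \<le> 1 + (cmod w + R)"
            using zw norm_triangle_ineq2[of z w] by (simp add: dist_norm)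
          also have "\<dots> \<le> (1 + R) * (1 + cmod w)" using R by (simp add: algebra_simps)
          finally show ?thesis .
        qed
        have b: "1 + cmod w \<le> (1 + R) * (1 + cmod z)"
        proof -
          have "1 + cmod w \<le> 1 + (cmod z + R)"
            using zw norm_triangle_ineq3[of z w] by (simp add: dist_norm)
          also have "\<dots> \<le> (1 + R) * (1 + cmod z)" using R by (simp add: algebra_simps)
          finally show ?thesis .
        qed
        have "dist z w * (1 + cmod w) \<le> dist z w * ((1 + R) * (1 + cmod z))"
          using b by (intro mult_left_mono) auto
        also have "\<dots> < R * (1 + R)"
          using True R by (simp add: mult.assoc mult.left_commute[of _ "1 + R"] mult.commute[of R])
        finally have "z \<in> ball w (R * (1 + R) / (1 + cmod w))"
          by (simp add: pos_less_divide_eq add_pos_nonneg dist_commute)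
        moreover have "(1 + cmod z)\<^sup>2 \<le> (1 + R)\<^sup>2 * (1 + cmod w)\<^sup>2"
          using power_mono[OF a, of 2] by (simp add: power_mult_distrib)
        ultimately show ?thesis
          using True by (simp add: k_def mult_right_mono ennreal_leI)
      qed (simp add: k_def)
    qed
    also have "\<dots> = (ennreal ((1 + R)\<^sup>2 * (1 + cmod w)\<^sup>2) * h w) * emeasure lborel (ball w (R * (1 + R) / (1 + cmod w)))"
      by (simp add: nn_integral_cmult_indicator)
    also have "emeasure lborel (ball w (R * (1 + R) / (1 + cmod w))) = ennreal (pi * (R * (1 + R) / (1 + cmod w))\<^sup>2)"
      using R by (simp add: emeasure_ball unit_ball_vol_2)
    also have "(ennreal ((1 + R)\<^sup>2 * (1 + cmod w)\<^sup>2) * h w) * ennreal (pi * (R * (1 + R) / (1 + cmod w))\<^sup>2)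
        = ennreal (((1 + R)\<^sup>2 * (1 + cmod w)\<^sup>2) * (pi * (R * (1 + R) / (1 + cmod w))\<^sup>2)) * h w"
      using R by (simp add: ennreal_mult mult_ac)
    also have "((1 + R)\<^sup>2 * (1 + cmod w)\<^sup>2) * (pi * (R * (1 + R) / (1 + cmod w))\<^sup>2) = pi * R\<^sup>2 * (1 + R) ^ 4"
    proof -
      have "1 + cmod w \<noteq> 0" using norm_ge_zero[of w] by linarith
      then show ?thesis by (simp add: power_divide power_mult_distrib power4_eq_xxxx power2_eq_square)
    qed
    finally show ?thesis .
  qed
  have "(\<integral>\<^sup>+z. ennreal ((1 + cmod z)\<^sup>2) *
            (\<integral>\<^sup>+w. h w * indicator (ball z (R / (1 + cmod z))) w \<partial>lborel) \<partial>lborel)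
       = (\<integral>\<^sup>+z. (\<integral>\<^sup>+w. k z w \<partial>lborel) \<partial>lborel)"
  proof (rule nn_integral_cong)
    fix z :: complex
    have "h w * indicator (ball z (R / (1 + cmod z))) w
        = (if dist z w * (1 + cmod z) < R then h w else 0)" for w
      unfolding indicator_def ball by simp
    then show "ennreal ((1 + cmod z)\<^sup>2) * (\<integral>\<^sup>+w. h w * indicator (ball z (R / (1 + cmod z))) w \<partial>lborel)
       = (\<integral>\<^sup>+w. k z w \<partial>lborel)"
      unfolding k_def by (simp add: nn_integral_cmult)
  qed
  also have "\<dots> = (\<integral>\<^sup>+w. (\<integral>\<^sup>+z. k z w \<partial>lborel) \<partial>lborel)"
    by (rule lborel_pair.Fubini') (simp add: k_def, measurable)
  also have "\<dots> \<le> (\<integral>\<^sup>+w. ennreal (pi * R\<^sup>2 * (1 + R) ^ 4) * h w \<partial>lborel)"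
    by (intro nn_integral_mono inner)
  also have "\<dots> = ennreal (pi * R\<^sup>2 * (1 + R) ^ 4) * (\<integral>\<^sup>+w. h w \<partial>lborel)"
    by (simp add: nn_integral_cmult)
  finally show ?thesis .
qed

text \<open>The difference of squares is (|w| - |\<xi>|)(|w| + |\<xi>|), where the first factor is
  of order 1 / (1 + |z|) and the second of order 1 + |z|. This balance fixes the radius of all the
  discs. The centre \<open>\<xi>\<close> may differ from the point \<open>z\<close> that sets the
  radius.\<close>

lemma norm_square_close:
  fixes z \<xi> w :: complex
  assumes "cmod \<xi> \<le> cmod z + 1" "dist \<xi> w \<le> 1 / (2 * (1 + cmod z))"
  shows "(cmod w)\<^sup>2 \<le> (cmod \<xi>)\<^sup>2 + 2" "(cmod \<xi>)\<^sup>2 \<le> (cmod w)\<^sup>2 + 2"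
    "dist \<xi> w \<le> 1 / 2"
proof -
  have pos: "0 < 1 + cmod z" using norm_ge_zero[of z] by linarith
  have d: "dist \<xi> w * (1 + cmod z) \<le> 1 / 2"
    using assms(2) pos by (simp add: field_simps)
  have half: "1 / (2 * (1 + cmod z)) \<le> 1 / 2" using pos by (simp add: field_simps)
  then show h: "dist \<xi> w \<le> 1 / 2" using assms(2) by linarith
  have "cmod w \<le> cmod \<xi> + dist \<xi> w"
    using norm_triangle_ineq3[of \<xi> w] by (simp add: dist_norm)
  then have s: "cmod w + cmod \<xi> \<le> 2 * (1 + cmod z) + 1 / 2" using assms(1) h by (simp add: algebra_simps)
  have "\<bar>(cmod w)\<^sup>2 - (cmod \<xi>)\<^sup>2\<bar> = \<bar>cmod w - cmod \<xi>\<bar> * (cmod w + cmod \<xi>)"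
    by (simp add: power2_eq_square square_diff_square_factored abs_mult)
  also have "\<dots> \<le> dist \<xi> w * (2 * (1 + cmod z) + 1 / 2)"
    using s norm_triangle_ineq3[of \<xi> w]
    by (intro mult_mono) (auto simp: dist_norm abs_minus_commute)
  also have "\<dots> = 2 * (dist \<xi> w * (1 + cmod z)) + dist \<xi> w / 2" by (simp add: algebra_simps)
  also have "\<dots> \<le> 2" using d h by linarith
  finally have "\<bar>(cmod w)\<^sup>2 - (cmod \<xi>)\<^sup>2\<bar> \<le> 2" .
  then show "(cmod w)\<^sup>2 \<le> (cmod \<xi>)\<^sup>2 + 2" "(cmod \<xi>)\<^sup>2 \<le> (cmod w)\<^sup>2 + 2" by linarith+
qed

lemma gauss_weight_le:
  fixes c x y :: real
  assumes "c \<ge> 0" "x \<le> y + 2"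
  shows "exp (- c * y) \<le> exp (2 * c) * exp (- c * x)"
proof -
  have "c * x \<le> c * (y + 2)" using assms by (intro mult_left_mono) auto
  then show ?thesis by (simp add: algebra_simps flip: exp_add)
qed

text \<open>On the disc the square of the modulus varies by at most 2, so the weight can be moved
  under the integral at the cost of \<open>exp (2 * c)\<close>; the factor (1 + |z|)^2 is the
  reciprocal of the squared radius. The radius depends on \<open>z\<close> rather than on
  \<open>\<xi>\<close> so that the estimate can be integrated in \<open>z\<close> with
  \<open>\<xi>\<close> chosen as an unspecified point depending on \<open>z\<close>.\<close>

lemma entire_gauss_submean:
  fixes q c :: real
  assumes q: "q > 0" and c: "c \<ge> 0"
  obtains C where "C > 0"
    and "\<And>F z \<xi>. F holomorphic_on UNIV \<Longrightarrow> cmod \<xi> \<le> cmod z + 1 \<Longrightarrow>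
      ennreal (cmod (F \<xi>) powr q * exp (- c * (cmod \<xi>)\<^sup>2))
        \<le> ennreal C * (ennreal ((1 + cmod z)\<^sup>2) *
          (\<integral>\<^sup>+w. ennreal (cmod (F w) powr q * exp (- c * (cmod w)\<^sup>2))
            * indicator (ball \<xi> (1 / (2 * (1 + cmod z)))) w \<partial>lborel))"
proof -
  obtain C where C: "C > 0"
    and sub: "\<And>F c R. F holomorphic_on UNIV \<Longrightarrow> R > 0 \<Longrightarrow>
      ennreal (R\<^sup>2 * cmod (F c) powr q)
        \<le> ennreal C * (\<integral>\<^sup>+w. ennreal (cmod (F w) powr q) * indicator (ball c R) w \<partial>lborel)"
    using entire_submean[OF q] by blast
  have "ennreal (cmod (F \<xi>) powr q * exp (- c * (cmod \<xi>)\<^sup>2))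
        \<le> ennreal (4 * C * exp (2 * c)) * (ennreal ((1 + cmod z)\<^sup>2) *
          (\<integral>\<^sup>+w. ennreal (cmod (F w) powr q * exp (- c * (cmod w)\<^sup>2))
            * indicator (ball \<xi> (1 / (2 * (1 + cmod z)))) w \<partial>lborel))"
    if hol: "F holomorphic_on UNIV" and le: "cmod \<xi> \<le> cmod z + 1" for F :: "complex \<Rightarrow> complex" and z \<xi>
  proof -
    define R where "R = 1 / (2 * (1 + cmod z))"
    define E where "E = exp (- c * (cmod \<xi>)\<^sup>2)"
    have zp: "0 < 1 + cmod z" using norm_ge_zero[of z] by linarith
    have R0: "R > 0" using zp by (simp add: R_def)
    have R2: "1 / R\<^sup>2 = 4 * (1 + cmod z)\<^sup>2"
      by (simp add: R_def power_mult_distrib power_divide del: distrib_left_numeral)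
    have [measurable]: "F \<in> borel_measurable borel"
      by (intro borel_measurable_continuous_onI holomorphic_on_imp_continuous_on hol)
    have "ennreal (cmod (F \<xi>) powr q * E) = ennreal (E / R\<^sup>2) * ennreal (R\<^sup>2 * cmod (F \<xi>) powr q)"
      using R0 by (simp add: E_def mult.commute flip: ennreal_mult')
    also have "\<dots> \<le> ennreal (E / R\<^sup>2) *
        (ennreal C * (\<integral>\<^sup>+w. ennreal (cmod (F w) powr q) * indicator (ball \<xi> R) w \<partial>lborel))"
      by (intro mult_left_mono sub hol R0) simp
    also have "\<dots> = ennreal (C / R\<^sup>2) *
        (\<integral>\<^sup>+w. ennreal E * (ennreal (cmod (F w) powr q) * indicator (ball \<xi> R) w) \<partial>lborel)"
    proof -
      have "ennreal (E / R\<^sup>2) * (ennreal C * X) = ennreal (C / R\<^sup>2) * (ennreal E * X)" for X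
      proof -
        have "ennreal (E / R\<^sup>2) * ennreal C = ennreal (C / R\<^sup>2) * ennreal E"
          using C by (simp add: E_def mult.commute flip: ennreal_mult')
        then show ?thesis by (simp flip: mult.assoc)
      qed
      moreover have "(\<integral>\<^sup>+w. ennreal E * (ennreal (cmod (F w) powr q) * indicator (ball \<xi> R) w) \<partial>lborel)
          = ennreal E * (\<integral>\<^sup>+w. ennreal (cmod (F w) powr q) * indicator (ball \<xi> R) w \<partial>lborel)"
        by (rule nn_integral_cmult_ball) measurable
      ultimately show ?thesis by simp
    qed
    also have "\<dots> \<le> ennreal (C / R\<^sup>2) *
        (\<integral>\<^sup>+w. ennreal (exp (2 * c)) * (ennreal (cmod (F w) powr q * exp (- c * (cmod w)\<^sup>2))
            * indicator (ball \<xi> R) w) \<partial>lborel)"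
    proof (intro mult_left_mono nn_integral_mono)
      fix w
      show "ennreal E * (ennreal (cmod (F w) powr q) * indicator (ball \<xi> R) w) \<le>
        ennreal (exp (2 * c)) * (ennreal (cmod (F w) powr q * exp (- c * (cmod w)\<^sup>2)) * indicator (ball \<xi> R) w)"
      proof (cases "w \<in> ball \<xi> R")
        case True
        then have "(cmod w)\<^sup>2 \<le> (cmod \<xi>)\<^sup>2 + 2"
          using norm_square_close(1)[OF le, of w] by (simp add: R_def)
        from gauss_weight_le[OF c this]
        have "E * cmod (F w) powr q \<le> (exp (2 * c) * exp (- c * (cmod w)\<^sup>2)) * cmod (F w) powr q"
          unfolding E_def by (rule mult_right_mono) simp
        then show ?thesis
          using True by (simp add: E_def mult_ac ennreal_leI flip: ennreal_mult')
      qed simp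
    qed simp
    also have "\<dots> = ennreal (C / R\<^sup>2) * (ennreal (exp (2 * c)) *
        (\<integral>\<^sup>+w. (ennreal (cmod (F w) powr q * exp (- c * (cmod w)\<^sup>2))
            * indicator (ball \<xi> R) w) \<partial>lborel))"
      by (subst nn_integral_cmult_ball) measurable
    also have "\<dots> = ennreal (4 * C * exp (2 * c)) * (ennreal ((1 + cmod z)\<^sup>2) *
        (\<integral>\<^sup>+w. (ennreal (cmod (F w) powr q * exp (- c * (cmod w)\<^sup>2))
            * indicator (ball \<xi> R) w) \<partial>lborel))"
    proof -
      have "C / R\<^sup>2 = 4 * C * (1 + cmod z)\<^sup>2" using R2 R0 by (metis mult.assoc mult.commute times_divide_eq_right mult_1_right)
      then have "ennreal (C / R\<^sup>2) * ennreal (exp (2 * c)) = ennreal (4 * C * exp (2 * c)) * ennreal ((1 + cmod z)\<^sup>2)"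
        using C by (simp add: mult_ac flip: ennreal_mult')
      then show ?thesis by (simp flip: mult.assoc)
    qed
    finally show ?thesis by (simp add: E_def R_def)
  qed
  moreover have "4 * C * exp (2 * c) > 0" using C by simp
  ultimately show thesis using that by blast
qed

section \<open>Derivatives and Gaussian integrals\<close>

text \<open>Cauchy's inequality on the circle of radius 1 / (2 (1 + |z|)) bounds |F' z| / (1 + |z|)
  by 2 |F \<xi>| for some \<open>\<xi>\<close> on the circle. The sub-mean value disc about
  \<open>\<xi>\<close> lies in the disc about z of twice the radius, so the moving-disc inequality
  with R = 1 finishes the proof.\<close>

lemma nn_integral_gauss_deriv_le:
  fixes q c :: real
  assumes q: "q > 0" and c: "c \<ge> 0"
  obtains C where "C > 0"
    and "\<And>F. F holomorphic_on UNIV \<Longrightarrow>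
      (\<integral>\<^sup>+z. ennreal ((cmod (deriv F z) / (1 + cmod z)) powr q * exp (- c * (cmod z)\<^sup>2)) \<partial>lborel)
        \<le> ennreal C * (\<integral>\<^sup>+w. ennreal (cmod (F w) powr q * exp (- c * (cmod w)\<^sup>2)) \<partial>lborel)"
proof -
  obtain C where C: "C > 0"
    and sub: "\<And>F z \<xi>. F holomorphic_on UNIV \<Longrightarrow> cmod \<xi> \<le> cmod z + 1 \<Longrightarrow>
      ennreal (cmod (F \<xi>) powr q * exp (- c * (cmod \<xi>)\<^sup>2))
        \<le> ennreal C * (ennreal ((1 + cmod z)\<^sup>2) *
          (\<integral>\<^sup>+w. ennreal (cmod (F w) powr q * exp (- c * (cmod w)\<^sup>2))
            * indicator (ball \<xi> (1 / (2 * (1 + cmod z)))) w \<partial>lborel))"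
    using entire_gauss_submean[OF q c] by blast
  \<comment> \<open>\<open>2 powr q\<close> comes from Cauchy's inequality and
    \<open>exp (2 * c)\<close> from moving the weight from \<open>z\<close> to \<open>\<xi>\<close>;
    below, \<open>pi * 16\<close> is the moving-disc constant for R = 1.\<close>
  define B where "B = 2 powr q * exp (2 * c)"
  have B0: "B > 0" by (simp add: B_def)
  have "(\<integral>\<^sup>+z. ennreal ((cmod (deriv F z) / (1 + cmod z)) powr q * exp (- c * (cmod z)\<^sup>2)) \<partial>lborel)
        \<le> ennreal (B * C * (pi * 16)) * (\<integral>\<^sup>+w. ennreal (cmod (F w) powr q * exp (- c * (cmod w)\<^sup>2)) \<partial>lborel)"
    if hol: "F holomorphic_on UNIV" for F :: "complex \<Rightarrow> complex"
  proof -
    have cont: "continuous_on S F" for S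
      using holomorphic_on_imp_continuous_on[OF hol] continuous_on_subset by blast
    have [measurable]: "F \<in> borel_measurable borel"
      by (intro borel_measurable_continuous_onI cont)
    define h where "h = (\<lambda>w. ennreal (cmod (F w) powr q * exp (- c * (cmod w)\<^sup>2)))"
    have h_meas [measurable]: "h \<in> borel_measurable borel" unfolding h_def by measurable
    have pt: "ennreal ((cmod (deriv F z) / (1 + cmod z)) powr q * exp (- c * (cmod z)\<^sup>2))
        \<le> ennreal (B * C) * (ennreal ((1 + cmod z)\<^sup>2) *
          (\<integral>\<^sup>+w. h w * indicator (ball z (1 / (1 + cmod z))) w \<partial>lborel))" for z
    proof -
      have zp: "0 < 1 + cmod z" using norm_ge_zero[of z] by linarith
      define r where "r = 1 / (2 * (1 + cmod z))"
      have r0: "r > 0" using zp by (simp add: r_def)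
      obtain \<xi> where \<xi>: "\<xi> \<in> sphere z r" and max: "\<And>x. x \<in> sphere z r \<Longrightarrow> cmod (F x) \<le> cmod (F \<xi>)"
        using continuous_attains_sup[of "sphere z r" "\<lambda>x. cmod (F x)"] r0
          continuous_on_norm[OF cont, of "sphere z r"] by auto
      have "norm ((deriv ^^ 1) F z) \<le> fact 1 * cmod (F \<xi>) / r ^ 1"
        by (rule Cauchy_inequality)
          (use r0 max cont in \<open>auto simp: dist_norm intro!: holomorphic_on_subset[OF hol]\<close>)
      then have "cmod (deriv F z) \<le> 2 * cmod (F \<xi>) * (1 + cmod z)"
        by (simp add: r_def algebra_simps)
      then have "cmod (deriv F z) / (1 + cmod z) \<le> 2 * cmod (F \<xi>)"
        using zp by (simp add: divide_le_eq)
      then have "(cmod (deriv F z) / (1 + cmod z)) powr q \<le> (2 * cmod (F \<xi>)) powr q"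
        using zp q by (intro powr_mono2) auto
      then have a: "(cmod (deriv F z) / (1 + cmod z)) powr q \<le> 2 powr q * cmod (F \<xi>) powr q"
        by (simp add: powr_mult)
      have dz: "dist z \<xi> \<le> 1 / (2 * (1 + cmod z))" using \<xi> by (simp add: r_def)
      note close = norm_square_close[of z z, OF _ dz]
      have b: "exp (- c * (cmod z)\<^sup>2) \<le> exp (2 * c) * exp (- c * (cmod \<xi>)\<^sup>2)"
        using close by (intro gauss_weight_le c) simp
      have "cmod \<xi> \<le> cmod z + dist z \<xi>"
        using norm_triangle_ineq3[of z \<xi>] by (simp add: dist_norm)
      then have le: "cmod \<xi> \<le> cmod z + 1" using close(3) by simp
      have "(cmod (deriv F z) / (1 + cmod z)) powr q * exp (- c * (cmod z)\<^sup>2)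
          \<le> (2 powr q * cmod (F \<xi>) powr q) * (exp (2 * c) * exp (- c * (cmod \<xi>)\<^sup>2))"
        by (intro mult_mono a b) auto
      also have "\<dots> = B * (cmod (F \<xi>) powr q * exp (- c * (cmod \<xi>)\<^sup>2))"
        by (simp add: B_def)
      finally have "ennreal ((cmod (deriv F z) / (1 + cmod z)) powr q * exp (- c * (cmod z)\<^sup>2))
          \<le> ennreal B * ennreal (cmod (F \<xi>) powr q * exp (- c * (cmod \<xi>)\<^sup>2))"
        using B0 by (simp add: ennreal_leI flip: ennreal_mult')
      also have "\<dots> \<le> ennreal B * (ennreal C * (ennreal ((1 + cmod z)\<^sup>2) *
          (\<integral>\<^sup>+w. h w * indicator (ball \<xi> (1 / (2 * (1 + cmod z)))) w \<partial>lborel)))"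
        unfolding h_def by (intro mult_left_mono sub hol le) simp
      also have "\<dots> \<le> ennreal B * (ennreal C * (ennreal ((1 + cmod z)\<^sup>2) *
          (\<integral>\<^sup>+w. h w * indicator (ball z (1 / (1 + cmod z))) w \<partial>lborel)))"
      proof (intro mult_left_mono nn_integral_mono)
        fix w
        have "w \<in> ball z (1 / (1 + cmod z))" if "w \<in> ball \<xi> (1 / (2 * (1 + cmod z)))"
        proof -
          have "dist z w < 1 / (2 * (1 + cmod z)) + 1 / (2 * (1 + cmod z))"
            using that dz dist_triangle[of z w \<xi>] by simp
          also have "\<dots> = 1 / (1 + cmod z)" by (simp del: distrib_left_numeral)
          finally show ?thesis by simp
        qed
        then show "indicator (ball \<xi> (1 / (2 * (1 + cmod z)))) w \<le> (indicator (ball z (1 / (1 + cmod z))) w :: ennreal)"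
          by (simp add: indicator_def)
      qed auto
      finally show ?thesis using B0 C by (simp add: ennreal_mult' mult.assoc)
    qed
    have "(\<integral>\<^sup>+z. ennreal ((cmod (deriv F z) / (1 + cmod z)) powr q * exp (- c * (cmod z)\<^sup>2)) \<partial>lborel)
        \<le> (\<integral>\<^sup>+z. ennreal (B * C) * (ennreal ((1 + cmod z)\<^sup>2) *
          (\<integral>\<^sup>+w. h w * indicator (ball z (1 / (1 + cmod z))) w \<partial>lborel)) \<partial>lborel)"
      by (intro nn_integral_mono pt)
    also have "\<dots> = ennreal (B * C) * (\<integral>\<^sup>+z. (ennreal ((1 + cmod z)\<^sup>2) *
          (\<integral>\<^sup>+w. h w * indicator (ball z (1 / (1 + cmod z))) w \<partial>lborel)) \<partial>lborel)"
      by (intro nn_integral_cmult borel_measurable_moving_disc) simp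
    also have "\<dots> \<le> ennreal (B * C) * (ennreal (pi * 1\<^sup>2 * (1 + 1) ^ 4) * (\<integral>\<^sup>+w. h w \<partial>lborel))"
      by (intro mult_left_mono nn_integral_moving_disc_le) auto
    also have "\<dots> = ennreal (B * C * (pi * 16)) * (\<integral>\<^sup>+w. h w \<partial>lborel)"
      using B0 C by (simp add: mult.assoc ennreal_mult')
    finally show ?thesis by (simp add: h_def)
  qed
  moreover have "B * C * (pi * 16) > 0" using B0 C by simp
  ultimately show thesis using that by blast
qed

text \<open>From a + b <= 2 max a b. This crude constant treats q < 1 and q >= 1 alike.\<close>

lemma powr_add_le:
  fixes a b q :: real
  assumes "a \<ge> 0" "b \<ge> 0" "q > 0"
  shows "(a + b) powr q \<le> 2 powr q * a powr q + 2 powr q * b powr q"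
proof -
  have "(a + b) powr q \<le> (2 * max a b) powr q" using assms by (intro powr_mono2) auto
  also have "\<dots> = 2 powr q * max a b powr q" using assms by (simp add: powr_mult)
  also have "\<dots> \<le> 2 powr q * a powr q + 2 powr q * b powr q"
    by (cases "a \<le> b") (auto simp: max_def)
  finally show ?thesis .
qed

text \<open>The absorption step. Finiteness of \<open>I\<close> is essential:
  \<open>I = \<infinity>\<close> satisfies the inequality even for \<open>X = 0\<close>.\<close>

lemma ennreal_le_half_self_add:
  fixes I X :: ennreal
  assumes "I \<le> ennreal (1 / 2) * I + X" "I < \<infinity>"
  shows "I \<le> 2 * X"
proof (cases "X = \<infinity>")
  case True
  then show ?thesis by (simp add: ennreal_mult_top)
next
  case False
  then obtain x where x: "X = ennreal x" "x \<ge> 0" by (cases X) auto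
  obtain i where i: "I = ennreal i" "i \<ge> 0" using assms(2) by (cases I) auto
  have "ennreal (1 / 2) * I + X = ennreal (1 / 2 * i + x)"
    using x i ennreal_mult'[of "1 / 2" i] by (subst ennreal_plus) auto
  then have "ennreal i \<le> ennreal (1 / 2 * i + x)" using assms(1) i by simp
  then have "i \<le> 2 * x" using x i by (subst (asm) ennreal_le_iff) auto
  then have "ennreal i \<le> ennreal (2 * x)" by (rule ennreal_leI)
  then show ?thesis using x i by (simp add: ennreal_mult')
qed

text \<open>The mean value inequality with the largest |F'| located at an actual point of the
  segment, so that a sub-mean value estimate for \<open>deriv F\<close> can be applied
  there.\<close>

lemma entire_diff_le_deriv_on_segment:
  assumes hol: "F holomorphic_on UNIV"
  obtains \<xi> where "\<xi> \<in> closed_segment a b" "cmod (F b - F a) \<le> cmod (deriv F \<xi>) * cmod (b - a)"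
proof -
  have "deriv F holomorphic_on UNIV" using hol by (intro holomorphic_deriv) auto
  then have "continuous_on (closed_segment a b) (\<lambda>x. cmod (deriv F x))"
    using holomorphic_on_imp_continuous_on continuous_on_subset by (intro continuous_on_norm) blast
  then obtain \<xi> where \<xi>: "\<xi> \<in> closed_segment a b"
    and max: "\<And>x. x \<in> closed_segment a b \<Longrightarrow> cmod (deriv F x) \<le> cmod (deriv F \<xi>)"
    using continuous_attains_sup[of "closed_segment a b" "\<lambda>x. cmod (deriv F x)"] by auto
  have "cmod (F b - F a) \<le> cmod (deriv F \<xi>) * cmod (b - a)"
  proof (rule field_differentiable_bound[of "closed_segment a b" F "deriv F"])
    fix z
    show "(F has_field_derivative deriv F z) (at z within closed_segment a b)"
      using hol holomorphic_derivI has_field_derivative_at_within open_UNIV by blast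
  qed (use max in auto)
  with \<xi> show thesis using that by blast
qed

text \<open>A step of length about \<open>L / (1 + |z|)\<close> towards the origin: it lowers \<open>|z|\<^sup>2\<close> by at
  least \<open>L / 4\<close>, so the Gaussian weight gains a factor that is exponential in \<open>L\<close>, while all other
  losses are polynomial in \<open>L\<close>.\<close>

definition step_in :: "real \<Rightarrow> complex \<Rightarrow> complex" where
  "step_in L z = (if L \<le> cmod z then of_real (1 - L / (1 + cmod z)\<^sup>2) * z else 0)"

text \<open>For |z| >= \<open>L\<close> the step removes the fraction L / (1 + |z|)^2 of z. As |z| /
  (1 + |z|) lies between 1/2 and 1, its length lies between L/2 and L, each divided by 1 + |z|. For
  smaller |z| the point jumps to 0, whence the extra factor \<open>1 + L\<close> in the
  unconditional bound. The last claim keeps a disc of radius 1 / (2 (1 + |z|)) about the new point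
  inside |w| <= |z|, as the truncation requires.\<close>

lemma step_in_props:
  assumes L: "L \<ge> 2"
  shows "cmod (step_in L z) \<le> cmod z"
    and "dist z (step_in L z) * (1 + cmod z) \<le> L * (1 + L)"
    and "L \<le> cmod z \<Longrightarrow> dist z (step_in L z) * (1 + cmod z) \<le> L"
    and "L \<le> cmod z \<Longrightarrow> (cmod (step_in L z))\<^sup>2 + L / 4 \<le> (cmod z)\<^sup>2"
    and "L \<le> cmod z \<Longrightarrow> cmod (step_in L z) + 1 / (2 * (1 + cmod z)) \<le> cmod z"
proof -
  have zp: "0 < 1 + cmod z" using norm_ge_zero[of z] by linarith
  define t where "t = L / (1 + cmod z)\<^sup>2"
  have t0: "t > 0" using L zp by (simp add: t_def)
  have far: "t \<le> 1" "dist z (step_in L z) = t * cmod z" "cmod (step_in L z) = (1 - t) * cmod z"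
    "t * cmod z * (1 + cmod z) \<le> L" "L / 2 \<le> t * cmod z * (1 + cmod z)"
    "L / 4 \<le> t * (cmod z)\<^sup>2"
    if le: "L \<le> cmod z"
  proof -
    have "cmod z \<le> (1 + cmod z)\<^sup>2" by (simp add: power2_eq_square algebra_simps)
    then show t1: "t \<le> 1" using le zp by (simp add: t_def divide_le_eq)
    have s: "step_in L z = of_real (1 - t) * z" using le by (simp add: step_in_def t_def)
    then have "z - step_in L z = of_real t * z" by (simp add: algebra_simps)
    then show "dist z (step_in L z) = t * cmod z" using t0 by (simp add: dist_norm norm_mult)
    show "cmod (step_in L z) = (1 - t) * cmod z" using t1 by (simp add: s norm_mult del: of_real_diff)
    have e: "t * cmod z * (1 + cmod z) = L * (cmod z / (1 + cmod z))"
      using zp by (simp add: t_def power2_eq_square)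
    have r1: "cmod z / (1 + cmod z) \<le> 1" using zp by (simp add: divide_le_eq)
    have r2: "1 / 2 \<le> cmod z / (1 + cmod z)" using zp le L by (simp add: le_divide_eq)
    show "t * cmod z * (1 + cmod z) \<le> L" unfolding e using mult_left_mono[OF r1, of L] L by simp
    show "L / 2 \<le> t * cmod z * (1 + cmod z)" unfolding e using mult_left_mono[OF r2, of L] L by simp
    have "(1 / 2)\<^sup>2 \<le> (cmod z / (1 + cmod z))\<^sup>2" by (intro power_mono r2) auto
    then have "L * (1 / 4) \<le> L * (cmod z / (1 + cmod z))\<^sup>2"
      using L by (intro mult_left_mono) (auto simp: power2_eq_square)
    then show "L / 4 \<le> t * (cmod z)\<^sup>2" by (simp add: t_def power_divide)
  qed
  show "cmod (step_in L z) \<le> cmod z"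
  proof (cases "L \<le> cmod z")
    case True
    then show ?thesis using far t0 by (simp add: mult_left_le_one_le)
  qed (simp add: step_in_def)
  show "dist z (step_in L z) * (1 + cmod z) \<le> L" if "L \<le> cmod z"
    using far that by simp
  then show "dist z (step_in L z) * (1 + cmod z) \<le> L * (1 + L)"
  proof (cases "L \<le> cmod z")
    case True
    then have "dist z (step_in L z) * (1 + cmod z) \<le> L" using far by simp
    also have "\<dots> \<le> L * (1 + L)" using L by simp
    finally show ?thesis .
  next
    case False
    then show ?thesis using L by (auto simp: step_in_def intro!: mult_mono)
  qed
  show "(cmod (step_in L z))\<^sup>2 + L / 4 \<le> (cmod z)\<^sup>2" if le: "L \<le> cmod z"
  proof -
    have "(1 - t)\<^sup>2 \<le> 1 - t" using far(1)[OF le] t0 by (simp add: power2_eq_square mult_left_le_one_le)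
    then have "(1 - t)\<^sup>2 * (cmod z)\<^sup>2 \<le> (1 - t) * (cmod z)\<^sup>2" by (intro mult_right_mono) auto
    then have "(cmod (step_in L z))\<^sup>2 \<le> (cmod z)\<^sup>2 - t * (cmod z)\<^sup>2"
      unfolding far(3)[OF le] power_mult_distrib by (simp add: left_diff_distrib)
    then show ?thesis using far(6)[OF le] by linarith
  qed
  show "cmod (step_in L z) + 1 / (2 * (1 + cmod z)) \<le> cmod z" if le: "L \<le> cmod z"
  proof -
    have "1 / 2 \<le> t * cmod z * (1 + cmod z)" using far(5)[OF le] L by linarith
    then have "1 / (2 * (1 + cmod z)) \<le> t * cmod z" using zp by (simp add: field_simps)
    then show ?thesis using far(3)[OF le] by (simp add: algebra_simps)
  qed
qed

text \<open>|F z| is at most the value at the inner point plus an increment. The first part is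
  averaged back into the integral of F with a coefficient that a large \<open>L\<close> makes at
  most 1/2; points with |z| < \<open>L\<close> contribute |F 0| instead. The increment is at most
  |F'| times a length of order 1 / (1 + |z|), which is where the quotient of \<open>deriv F\<close>
  by 1 + |z| comes from.\<close>

lemma nn_integral_gauss_le_deriv:
  fixes q c :: real
  assumes q: "q > 0" and c: "c > 0"
  obtains C where "C > 0"
    and "\<And>F. F holomorphic_on UNIV \<Longrightarrow>
      (\<integral>\<^sup>+w. ennreal (cmod (F w) powr q * exp (- c * (cmod w)\<^sup>2)) \<partial>lborel)
        \<le> ennreal C * (ennreal (cmod (F 0) powr q) +
          (\<integral>\<^sup>+z. ennreal ((cmod (deriv F z) / (1 + cmod z)) powr q * exp (- c * (cmod z)\<^sup>2)) \<partial>lborel))"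
proof -
  obtain C where C: "C > 0"
    and sub: "\<And>F z \<xi>. F holomorphic_on UNIV \<Longrightarrow> cmod \<xi> \<le> cmod z + 1 \<Longrightarrow>
      ennreal (cmod (F \<xi>) powr q * exp (- c * (cmod \<xi>)\<^sup>2))
        \<le> ennreal C * (ennreal ((1 + cmod z)\<^sup>2) *
          (\<integral>\<^sup>+w. ennreal (cmod (F w) powr q * exp (- c * (cmod w)\<^sup>2))
            * indicator (ball \<xi> (1 / (2 * (1 + cmod z)))) w \<partial>lborel))"
    using entire_gauss_submean[OF q less_imp_le[OF c]] by blast
  \<comment> \<open>The expression made small next is the coefficient of the absorbed term, namely
    \<open>K1\<close> times the moving-disc constant for \<open>R3 = L + 1\<close>. \<open>L\<close>
    is fixed before \<open>F\<close>, so all constants are uniform in \<open>F\<close>.\<close>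
  define D where "D = 2 powr q * C * pi"
  have "((\<lambda>L. D * exp (- c * (L / 4)) * ((L + 1)\<^sup>2 * (1 + (L + 1)) ^ 4)) \<longlongrightarrow> 0) at_top"
    using c by real_asymp
  then have "\<forall>\<^sub>F L in at_top. D * exp (- c * (L / 4)) * ((L + 1)\<^sup>2 * (1 + (L + 1)) ^ 4) < 1 / 2"
    by (rule order_tendstoD) simp
  then have "\<forall>\<^sub>F L in at_top. D * exp (- c * (L / 4)) * ((L + 1)\<^sup>2 * (1 + (L + 1)) ^ 4) < 1 / 2 \<and> L \<ge> 2"
    using eventually_ge_at_top[of "2::real"] by eventually_elim simp
  then obtain L where L2: "L \<ge> 2"
    and Lsmall: "D * exp (- c * (L / 4)) * ((L + 1)\<^sup>2 * (1 + (L + 1)) ^ 4) < 1 / 2"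
    using eventually_happens by (metis (mono_tags, lifting) trivial_limit_at_top_linorder)
  note step = step_in_props[OF L2]
  \<comment> \<open>All three are radii up to division by 1 + |z|: \<open>R1\<close> bounds the
    step, \<open>R2\<close> leaves room for a small disc about any point of the segment, and
    \<open>R3\<close> does so for the inner endpoint, using the sharper step bound valid for |z| >=
    \<open>L\<close>.\<close>
  define R1 where "R1 = L * (1 + L)"
  define R2 where "R2 = R1 + 1"
  define R3 where "R3 = L + 1"
  define K1 where "K1 = 2 powr q * exp (- c * (L / 4)) * C"
  define K2 where "K2 = 2 powr q * R1 powr q * 2 powr q * C"
  have R: "R1 > 0" "R2 > 0" "R3 > 0" using L2 by (auto simp: R1_def R2_def R3_def add_pos_pos)
  have K: "K1 > 0" "K2 > 0" using C R by (auto simp: K1_def K2_def)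
  define P0 where "P0 = 2 powr q * (pi * L\<^sup>2)"
  define P2 where "P2 = K2 * (pi * R2\<^sup>2 * (1 + R2) ^ 4)"
  define C' where "C' = 2 * max P0 P2"
  have P: "P0 > 0" "P2 > 0" using L2 R K by (auto simp: P0_def P2_def)
  have "(\<integral>\<^sup>+w. ennreal (cmod (F w) powr q * exp (- c * (cmod w)\<^sup>2)) \<partial>lborel)
        \<le> ennreal C' * (ennreal (cmod (F 0) powr q) +
          (\<integral>\<^sup>+z. ennreal ((cmod (deriv F z) / (1 + cmod z)) powr q * exp (- c * (cmod z)\<^sup>2)) \<partial>lborel))"
    if hol: "F holomorphic_on UNIV" for F :: "complex \<Rightarrow> complex"
  proof -
    have hol': "deriv F holomorphic_on UNIV" using hol by (intro holomorphic_deriv) auto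
    have cont: "continuous_on S F" "continuous_on S (deriv F)" for S
      using holomorphic_on_imp_continuous_on[OF hol] holomorphic_on_imp_continuous_on[OF hol']
        continuous_on_subset by blast+
    have [measurable]: "F \<in> borel_measurable borel" "deriv F \<in> borel_measurable borel"
      by (intro borel_measurable_continuous_onI cont)+
    define U where "U = (\<lambda>w. ennreal (cmod (F w) powr q * exp (- c * (cmod w)\<^sup>2)))"
    define V where "V = (\<lambda>z. ennreal ((cmod (deriv F z) / (1 + cmod z)) powr q * exp (- c * (cmod z)\<^sup>2)))"
    have [measurable]: "U \<in> borel_measurable borel" "V \<in> borel_measurable borel"
      unfolding U_def V_def by measurable
    define X where "X = ennreal P0 * ennreal (cmod (F 0) powr q) + ennreal P2 * (\<integral>\<^sup>+z. V z \<partial>lborel)"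

    \<comment> \<open>The cutoff to \<open>ball 0 N\<close> survives on the right because, for |z|
      >= \<open>L\<close>, the disc about \<open>step_in L z\<close> stays in |w| < |z| < N. For |z|
      < \<open>L\<close> the inner point is 0 and only the indicator term is used.\<close>
    have first: "ennreal (2 powr q * (cmod (F (step_in L z)) powr q * exp (- c * (cmod z)\<^sup>2)))
        \<le> ennreal (2 powr q * cmod (F 0) powr q) * indicator (ball 0 L) z
          + ennreal K1 * (ennreal ((1 + cmod z)\<^sup>2) *
            (\<integral>\<^sup>+w. (U w * indicator (ball 0 N) w) * indicator (ball z (R3 / (1 + cmod z))) w \<partial>lborel))"
      if z: "z \<in> ball 0 N" for z N
    proof (cases "L \<le> cmod z")
      case False
      then have "step_in L z = 0" by (simp add: step_in_def)
      moreover have "cmod (F 0) powr q * exp (- c * (cmod z)\<^sup>2) \<le> cmod (F 0) powr q * 1"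
        using c by (intro mult_left_mono) auto
      ultimately have "ennreal (2 powr q * (cmod (F (step_in L z)) powr q * exp (- c * (cmod z)\<^sup>2)))
          \<le> ennreal (2 powr q * cmod (F 0) powr q) * indicator (ball 0 L) z"
        using False by (simp add: ennreal_leI)
      then show ?thesis by (rule order_trans) simp
    next
      case True
      define \<xi> where "\<xi> = step_in L z"
      have zp: "0 < 1 + cmod z" using norm_ge_zero[of z] by linarith
      have "c * ((cmod \<xi>)\<^sup>2 + L / 4) \<le> c * (cmod z)\<^sup>2"
        using step(4)[OF True] c by (intro mult_left_mono) (auto simp: \<xi>_def)
      then have "exp (- c * (cmod z)\<^sup>2) \<le> exp (- c * (L / 4)) * exp (- c * (cmod \<xi>)\<^sup>2)"
        by (simp add: algebra_simps flip: exp_add)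
      then have "2 powr q * (cmod (F \<xi>) powr q * exp (- c * (cmod z)\<^sup>2))
          \<le> 2 powr q * (cmod (F \<xi>) powr q * (exp (- c * (L / 4)) * exp (- c * (cmod \<xi>)\<^sup>2)))"
        by (intro mult_left_mono) auto
      then have "ennreal (2 powr q * (cmod (F \<xi>) powr q * exp (- c * (cmod z)\<^sup>2)))
          \<le> ennreal (2 powr q * exp (- c * (L / 4))) * ennreal (cmod (F \<xi>) powr q * exp (- c * (cmod \<xi>)\<^sup>2))"
        by (simp add: mult_ac ennreal_leI flip: ennreal_mult')
      also have "\<dots> \<le> ennreal (2 powr q * exp (- c * (L / 4))) * (ennreal C * (ennreal ((1 + cmod z)\<^sup>2) *
          (\<integral>\<^sup>+w. U w * indicator (ball \<xi> (1 / (2 * (1 + cmod z)))) w \<partial>lborel)))"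
        unfolding U_def using step(1)[of z] by (intro mult_left_mono sub hol) (auto simp: \<xi>_def)
      also have "\<dots> \<le> ennreal (2 powr q * exp (- c * (L / 4))) * (ennreal C * (ennreal ((1 + cmod z)\<^sup>2) *
          (\<integral>\<^sup>+w. (U w * indicator (ball 0 N) w) * indicator (ball z (R3 / (1 + cmod z))) w \<partial>lborel)))"
      proof (intro mult_left_mono nn_integral_mono)
        fix w
        show "U w * indicator (ball \<xi> (1 / (2 * (1 + cmod z)))) w
            \<le> (U w * indicator (ball 0 N) w) * indicator (ball z (R3 / (1 + cmod z))) w"
        proof (cases "w \<in> ball \<xi> (1 / (2 * (1 + cmod z)))")
          case w: True
          have "cmod w \<le> cmod \<xi> + dist \<xi> w"
            using norm_triangle_ineq3[of \<xi> w] by (simp add: dist_norm)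
          also have "\<dots> < cmod z" using w step(5)[OF True] by (simp add: \<xi>_def)
          finally have 1: "w \<in> ball 0 N" using z by simp
          have "dist z w * (1 + cmod z) \<le> dist z \<xi> * (1 + cmod z) + dist \<xi> w * (1 + cmod z)"
            using dist_triangle[of z w \<xi>] zp by (simp flip: distrib_right)
          also have "\<dots> < L + 1"
          proof -
            have "dist \<xi> w * (1 + cmod z) < 1" using w zp by (simp add: field_simps)
            then show ?thesis using step(3)[OF True] by (simp add: \<xi>_def)
          qed
          finally have "w \<in> ball z (R3 / (1 + cmod z))"
            using zp by (simp add: R3_def pos_less_divide_eq)
          with 1 show ?thesis by (auto simp: indicator_def)
        qed simp
      qed auto
      finally have "ennreal (2 powr q * (cmod (F \<xi>) powr q * exp (- c * (cmod z)\<^sup>2)))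
        \<le> ennreal K1 * (ennreal ((1 + cmod z)\<^sup>2) *
            (\<integral>\<^sup>+w. (U w * indicator (ball 0 N) w) * indicator (ball z (R3 / (1 + cmod z))) w \<partial>lborel))"
        using C by (simp add: K1_def ennreal_mult' mult.assoc)
      then show ?thesis unfolding \<xi>_def by (rule order_trans) simp
    qed

    \<comment> \<open>The weight only increases when passing from \<open>z\<close> to
      \<open>\<xi>\<close>, as |\<xi>| <= |z|. The factor 1 / (1 + |z|) from the step length becomes
      1 / (1 + |w|) inside the integral because 1 + |w| <= 2 (1 + |z|) on the disc; this costs the
      second \<open>2 powr q\<close> in \<open>K2\<close>.\<close>
    have second: "ennreal (2 powr q * ((cmod (deriv F \<xi>) * cmod (z - step_in L z)) powr q * exp (- c * (cmod z)\<^sup>2)))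
        \<le> ennreal K2 * (ennreal ((1 + cmod z)\<^sup>2) *
            (\<integral>\<^sup>+w. V w * indicator (ball z (R2 / (1 + cmod z))) w \<partial>lborel))"
      if seg: "\<xi> \<in> closed_segment (step_in L z) z" for \<xi> z
    proof -
      have zp: "0 < 1 + cmod z" using norm_ge_zero[of z] by linarith
      have "closed_segment (step_in L z) z \<subseteq> cball 0 (cmod z)"
        using step(1)[of z] by (intro closed_segment_subset) auto
      then have \<xi>z: "cmod \<xi> \<le> cmod z" using seg by auto
      have d\<xi>: "dist z \<xi> \<le> dist z (step_in L z)"
        using seg segment_bound(2)[OF seg] by (simp add: dist_norm norm_minus_commute)
      have dz: "cmod (z - step_in L z) \<le> R1 / (1 + cmod z)"
        using step(2)[of z] zp by (simp add: R1_def pos_le_divide_eq dist_norm)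
      have "(cmod (deriv F \<xi>) * cmod (z - step_in L z)) powr q
          \<le> (cmod (deriv F \<xi>) * (R1 / (1 + cmod z))) powr q"
        using q dz by (intro powr_mono2 mult_left_mono) auto
      also have "\<dots> = R1 powr q * (cmod (deriv F \<xi>) powr q / (1 + cmod z) powr q)"
        using R zp by (simp add: powr_mult powr_divide)
      finally have 1: "(cmod (deriv F \<xi>) * cmod (z - step_in L z)) powr q
          \<le> R1 powr q * (cmod (deriv F \<xi>) powr q / (1 + cmod z) powr q)" .
      have 2: "exp (- c * (cmod z)\<^sup>2) \<le> exp (- c * (cmod \<xi>)\<^sup>2)"
        using \<xi>z c by (simp add: power_mono)
      have "2 powr q * ((cmod (deriv F \<xi>) * cmod (z - step_in L z)) powr q * exp (- c * (cmod z)\<^sup>2))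
          \<le> 2 powr q * ((R1 powr q * (cmod (deriv F \<xi>) powr q / (1 + cmod z) powr q)) * exp (- c * (cmod \<xi>)\<^sup>2))"
        by (intro mult_left_mono mult_mono 1 2) auto
      also have "\<dots> = (2 powr q * R1 powr q / (1 + cmod z) powr q) * (cmod (deriv F \<xi>) powr q * exp (- c * (cmod \<xi>)\<^sup>2))"
        by simp
      finally have "ennreal (2 powr q * ((cmod (deriv F \<xi>) * cmod (z - step_in L z)) powr q * exp (- c * (cmod z)\<^sup>2)))
          \<le> ennreal (2 powr q * R1 powr q / (1 + cmod z) powr q) * ennreal (cmod (deriv F \<xi>) powr q * exp (- c * (cmod \<xi>)\<^sup>2))"
        by (simp add: ennreal_leI flip: ennreal_mult')
      also have "\<dots> \<le> ennreal (2 powr q * R1 powr q / (1 + cmod z) powr q) * (ennreal C * (ennreal ((1 + cmod z)\<^sup>2) *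
          (\<integral>\<^sup>+w. ennreal (cmod (deriv F w) powr q * exp (- c * (cmod w)\<^sup>2))
            * indicator (ball \<xi> (1 / (2 * (1 + cmod z)))) w \<partial>lborel)))"
        using \<xi>z by (intro mult_left_mono sub hol') auto
      also have "\<dots> = ennreal (2 powr q * R1 powr q * C) * (ennreal ((1 + cmod z)\<^sup>2) *
          (\<integral>\<^sup>+w. ennreal (1 / (1 + cmod z) powr q) * (ennreal (cmod (deriv F w) powr q * exp (- c * (cmod w)\<^sup>2))
            * indicator (ball \<xi> (1 / (2 * (1 + cmod z)))) w) \<partial>lborel))"
      proof -
        have e: "ennreal (2 powr q * R1 powr q / (1 + cmod z) powr q) * ennreal C
            = ennreal (2 powr q * R1 powr q * C) * ennreal (1 / (1 + cmod z) powr q)"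
          using C by (simp flip: ennreal_mult')
        have "ennreal (2 powr q * R1 powr q / (1 + cmod z) powr q) * (ennreal C * (B * Y))
            = ennreal (2 powr q * R1 powr q * C) * (B * (ennreal (1 / (1 + cmod z) powr q) * Y))" for B Y
          using arg_cong[OF e, of "\<lambda>x. x * (B * Y)"] by (simp add: mult_ac)
        moreover have "(\<integral>\<^sup>+w. ennreal (1 / (1 + cmod z) powr q) * (ennreal (cmod (deriv F w) powr q * exp (- c * (cmod w)\<^sup>2))
            * indicator (ball \<xi> (1 / (2 * (1 + cmod z)))) w) \<partial>lborel)
          = ennreal (1 / (1 + cmod z) powr q) * (\<integral>\<^sup>+w. ennreal (cmod (deriv F w) powr q * exp (- c * (cmod w)\<^sup>2))
            * indicator (ball \<xi> (1 / (2 * (1 + cmod z)))) w \<partial>lborel)"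
          by (rule nn_integral_cmult_ball) measurable
        ultimately show ?thesis by simp
      qed
      also have "\<dots> \<le> ennreal (2 powr q * R1 powr q * C) * (ennreal ((1 + cmod z)\<^sup>2) *
          (\<integral>\<^sup>+w. ennreal (2 powr q) * (V w * indicator (ball z (R2 / (1 + cmod z))) w) \<partial>lborel))"
      proof (intro mult_left_mono nn_integral_mono)
        fix w
        show "ennreal (1 / (1 + cmod z) powr q) * (ennreal (cmod (deriv F w) powr q * exp (- c * (cmod w)\<^sup>2))
            * indicator (ball \<xi> (1 / (2 * (1 + cmod z)))) w)
          \<le> ennreal (2 powr q) * (V w * indicator (ball z (R2 / (1 + cmod z))) w)"
        proof (cases "w \<in> ball \<xi> (1 / (2 * (1 + cmod z)))")
          case w: True
          have "dist z w * (1 + cmod z) \<le> dist z \<xi> * (1 + cmod z) + dist \<xi> w * (1 + cmod z)"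
            using dist_triangle[of z w \<xi>] zp by (simp flip: distrib_right)
          also have "\<dots> < R1 + 1"
          proof -
            have "dist \<xi> w * (1 + cmod z) < 1" using w zp by (simp add: field_simps)
            moreover have "dist z \<xi> * (1 + cmod z) \<le> R1"
              using order_trans[OF mult_right_mono[OF d\<xi>] step(2)[of z]] zp by (simp add: R1_def)
            ultimately show ?thesis by linarith
          qed
          finally have wz: "w \<in> ball z (R2 / (1 + cmod z))"
            using zp by (simp add: R2_def pos_less_divide_eq)
          have "dist \<xi> w \<le> 1 / 2"
            using norm_square_close(3)[of \<xi> z w] w \<xi>z by simp
          then have "cmod w \<le> cmod \<xi> + 1"
            using norm_triangle_ineq3[of \<xi> w] by (simp add: dist_norm)
          then have "1 + cmod w \<le> 2 + cmod z" using \<xi>z by simp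
          also have "\<dots> \<le> 2 * (1 + cmod z)" by simp
          finally have wle: "1 + cmod w \<le> 2 * (1 + cmod z)" .
          have wp: "0 < 1 + cmod w" using norm_ge_zero[of w] by linarith
          have "(1 + cmod w) powr q \<le> (2 * (1 + cmod z)) powr q"
            using q wle wp by (intro powr_mono2) auto
          then have "(1 + cmod w) powr q \<le> 2 powr q * (1 + cmod z) powr q"
            using zp by (subst (asm) powr_mult) auto
          then have "1 / (1 + cmod z) powr q \<le> 2 powr q / (1 + cmod w) powr q"
            using zp wp by (simp add: divide_le_eq le_divide_eq mult.commute)
          then have "1 / (1 + cmod z) powr q * (cmod (deriv F w) powr q * exp (- c * (cmod w)\<^sup>2))
              \<le> 2 powr q / (1 + cmod w) powr q * (cmod (deriv F w) powr q * exp (- c * (cmod w)\<^sup>2))"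
            by (intro mult_right_mono) auto
          also have "\<dots> = 2 powr q * ((cmod (deriv F w) / (1 + cmod w)) powr q * exp (- c * (cmod w)\<^sup>2))"
            using wp by (simp add: powr_divide)
          finally show ?thesis
            using w wz by (simp add: V_def ennreal_leI flip: ennreal_mult')
        qed simp
      qed auto
      also have "\<dots> = ennreal K2 * (ennreal ((1 + cmod z)\<^sup>2) *
            (\<integral>\<^sup>+w. V w * indicator (ball z (R2 / (1 + cmod z))) w \<partial>lborel))"
        using C by (subst nn_integral_cmult_ball) (simp_all add: K2_def ennreal_mult' mult_ac)
      finally show ?thesis .
    qed

    \<comment> \<open>The truncated integral is finite because \<open>F\<close> is bounded on the
      compact disc, which makes the absorption legitimate. \<open>X\<close> does not involve
      \<open>N\<close>, so monotone convergence then removes the truncation.\<close>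
    have trunc: "(\<integral>\<^sup>+z. U z * indicator (ball 0 N) z \<partial>lborel) \<le> 2 * X" for N
    proof (rule ennreal_le_half_self_add)
      define T1 where "T1 = (\<lambda>z. ennreal ((1 + cmod z)\<^sup>2) *
            (\<integral>\<^sup>+w. (U w * indicator (ball 0 N) w) * indicator (ball z (R3 / (1 + cmod z))) w \<partial>lborel))"
      define T2 where "T2 = (\<lambda>z. ennreal ((1 + cmod z)\<^sup>2) *
            (\<integral>\<^sup>+w. V w * indicator (ball z (R2 / (1 + cmod z))) w \<partial>lborel))"
      have [measurable]: "ball a r \<in> sets borel" for a :: complex and r by simp
      have UN [measurable]: "(\<lambda>w. U w * indicator (ball 0 N) w) \<in> borel_measurable borel"
        by measurable
      have [measurable]: "T1 \<in> borel_measurable borel" "T2 \<in> borel_measurable borel"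
        using borel_measurable_moving_disc[OF UN, of R3] borel_measurable_moving_disc[of V R2]
        by (simp_all add: T1_def T2_def)
      have "(\<integral>\<^sup>+z. U z * indicator (ball 0 N) z \<partial>lborel) \<le>
          (\<integral>\<^sup>+z. ennreal (2 powr q * cmod (F 0) powr q) * indicator (ball 0 L) z + ennreal K1 * T1 z + ennreal K2 * T2 z \<partial>lborel)"
      proof (rule nn_integral_mono)
        fix z
        show "U z * indicator (ball 0 N) z \<le>
           ennreal (2 powr q * cmod (F 0) powr q) * indicator (ball 0 L) z + ennreal K1 * T1 z + ennreal K2 * T2 z"
        proof (cases "z \<in> ball 0 N")
          case z: True
          obtain \<xi> where \<xi>: "\<xi> \<in> closed_segment (step_in L z) z"
            and d: "cmod (F z - F (step_in L z)) \<le> cmod (deriv F \<xi>) * cmod (z - step_in L z)"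
            using entire_diff_le_deriv_on_segment[OF hol] by blast
          have "cmod (F z) \<le> cmod (F (step_in L z)) + cmod (deriv F \<xi>) * cmod (z - step_in L z)"
            using d norm_triangle_ineq2[of "F z" "F (step_in L z)"] by linarith
          then have "cmod (F z) powr q \<le> (cmod (F (step_in L z)) + cmod (deriv F \<xi>) * cmod (z - step_in L z)) powr q"
            using q by (intro powr_mono2) auto
          also have "\<dots> \<le> 2 powr q * cmod (F (step_in L z)) powr q
              + 2 powr q * (cmod (deriv F \<xi>) * cmod (z - step_in L z)) powr q"
            using q by (intro powr_add_le) auto
          finally have "cmod (F z) powr q * exp (- c * (cmod z)\<^sup>2) \<le>
            (2 powr q * cmod (F (step_in L z)) powr q
              + 2 powr q * (cmod (deriv F \<xi>) * cmod (z - step_in L z)) powr q) * exp (- c * (cmod z)\<^sup>2)"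
            by (intro mult_right_mono) auto
          then have "U z \<le> ennreal (2 powr q * (cmod (F (step_in L z)) powr q * exp (- c * (cmod z)\<^sup>2)))
             + ennreal (2 powr q * ((cmod (deriv F \<xi>) * cmod (z - step_in L z)) powr q * exp (- c * (cmod z)\<^sup>2)))"
            by (simp add: U_def ennreal_leI algebra_simps flip: ennreal_plus)
          also have "\<dots> \<le> (ennreal (2 powr q * cmod (F 0) powr q) * indicator (ball 0 L) z + ennreal K1 * T1 z) + ennreal K2 * T2 z"
            unfolding T1_def T2_def by (intro add_mono first second z \<xi>)
          finally show ?thesis using z by simp
        qed simp
      qed
      also have "\<dots> = ennreal (2 powr q * cmod (F 0) powr q) * emeasure lborel (ball 0 L :: complex set)
          + ennreal K1 * (\<integral>\<^sup>+z. T1 z \<partial>lborel) + ennreal K2 * (\<integral>\<^sup>+z. T2 z \<partial>lborel)"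
        by (simp add: nn_integral_add nn_integral_cmult nn_integral_cmult_indicator)
      also have "\<dots> \<le> ennreal (2 powr q * cmod (F 0) powr q) * ennreal (pi * L\<^sup>2)
          + ennreal K1 * (ennreal (pi * R3\<^sup>2 * (1 + R3) ^ 4) * (\<integral>\<^sup>+z. U z * indicator (ball 0 N) z \<partial>lborel))
          + ennreal K2 * (ennreal (pi * R2\<^sup>2 * (1 + R2) ^ 4) * (\<integral>\<^sup>+z. V z \<partial>lborel))"
        unfolding T1_def T2_def using R L2
        by (intro add_mono mult_left_mono nn_integral_moving_disc_le)
           (auto simp: emeasure_ball unit_ball_vol_2)
      also have "\<dots> = ennreal (K1 * (pi * R3\<^sup>2 * (1 + R3) ^ 4)) * (\<integral>\<^sup>+z. U z * indicator (ball 0 N) z \<partial>lborel) + X"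
        using K R L2 by (simp add: X_def P0_def P2_def ennreal_mult' mult_ac add_ac)
      also have "\<dots> \<le> ennreal (1 / 2) * (\<integral>\<^sup>+z. U z * indicator (ball 0 N) z \<partial>lborel) + X"
      proof (intro add_mono mult_right_mono ennreal_leI)
        show "K1 * (pi * R3\<^sup>2 * (1 + R3) ^ 4) \<le> 1 / 2"
          using Lsmall by (simp add: K1_def D_def R3_def mult_ac)
      qed auto
      finally show "(\<integral>\<^sup>+z. U z * indicator (ball 0 N) z \<partial>lborel)
          \<le> ennreal (1 / 2) * (\<integral>\<^sup>+z. U z * indicator (ball 0 N) z \<partial>lborel) + X" .
      have "bounded (F ` cball 0 N)"
        by (intro compact_imp_bounded compact_continuous_image cont) auto
      then obtain b where b: "\<And>w. w \<in> cball 0 N \<Longrightarrow> cmod (F w) \<le> b"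
        unfolding bounded_iff by blast
      have "(\<integral>\<^sup>+z. U z * indicator (ball 0 N) z \<partial>lborel) \<le> (\<integral>\<^sup>+z. ennreal (b powr q) * indicator (ball (0::complex) N) z \<partial>lborel)"
      proof (rule nn_integral_mono)
        fix z
        show "U z * indicator (ball 0 N) z \<le> ennreal (b powr q) * indicator (ball 0 N) z"
        proof (cases "z \<in> ball 0 N")
          case True
          then have "cmod (F z) powr q \<le> b powr q" using b[of z] q by (intro powr_mono2) auto
          moreover have "exp (- c * (cmod z)\<^sup>2) \<le> 1" using c by simp
          ultimately have "cmod (F z) powr q * exp (- c * (cmod z)\<^sup>2) \<le> b powr q * 1"
            by (intro mult_mono) auto
          then show ?thesis using True by (simp add: U_def ennreal_leI)
        qed simp
      qed
      also have "\<dots> = ennreal (b powr q) * emeasure lborel (ball 0 N :: complex set)"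
        by (simp add: nn_integral_cmult_indicator)
      also have "\<dots> < \<infinity>"
        using emeasure_lborel_ball_finite[of "0::complex" N] by (simp add: ennreal_mult_less_top)
      finally show "(\<integral>\<^sup>+z. U z * indicator (ball 0 N) z \<partial>lborel) < \<infinity>" .
    qed
    have "(\<integral>\<^sup>+z. U z \<partial>lborel) = (\<integral>\<^sup>+z. (SUP n. U z * indicator (ball 0 (real n)) z) \<partial>lborel)"
    proof (rule nn_integral_cong)
      fix z :: complex
      obtain n where "cmod z < real n" using reals_Archimedean2 by blast
      then have "U z = U z * indicator (ball 0 (real n)) z" by simp
      also have "\<dots> \<le> (SUP n. U z * indicator (ball 0 (real n)) z)" by (rule SUP_upper) simp
      finally show "U z = (SUP n. U z * indicator (ball 0 (real n)) z)"
        by (intro antisym SUP_least) (auto simp: indicator_def)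
    qed
    also have "\<dots> = (SUP n. (\<integral>\<^sup>+z. U z * indicator (ball 0 (real n)) z \<partial>lborel))"
      by (intro nn_integral_monotone_convergence_SUP)
         (auto simp: incseq_def le_fun_def indicator_def)
    also have "\<dots> \<le> 2 * X" by (intro SUP_least trunc)
    also have "\<dots> \<le> 2 * (ennreal (max P0 P2) * ennreal (cmod (F 0) powr q) + ennreal (max P0 P2) * (\<integral>\<^sup>+z. V z \<partial>lborel))"
      unfolding X_def by (intro mult_left_mono add_mono mult_right_mono ennreal_leI) auto
    also have "\<dots> = ennreal C' * (ennreal (cmod (F 0) powr q) + (\<integral>\<^sup>+z. V z \<partial>lborel))"
      using P by (simp add: C'_def ennreal_mult' distrib_left mult.assoc)
    finally show ?thesis unfolding U_def V_def .
  qed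
  moreover have "C' > 0" using P by (simp add: C'_def)
  ultimately show thesis using that by blast
qed

section \<open>Derivatives and Gaussian suprema\<close>

text \<open>Cauchy's inequality on the circle of radius 1 / (2 (1 + |z|)): there the squared modulus
  exceeds |z|^2 by at most 2, so the Gaussian grows by at most \<open>exp \<alpha>\<close>, and the
  reciprocal radius is \<open>2 * (1 + cmod z)\<close>.\<close>

lemma entire_gauss_bound_deriv:
  fixes \<alpha> M :: real
  assumes \<alpha>: "\<alpha> \<ge> 0" and hol: "F holomorphic_on UNIV"
    and bound: "\<And>z. cmod (F z) \<le> M * exp (\<alpha> / 2 * (cmod z)\<^sup>2)"
  shows "cmod (deriv F z) \<le> 2 * exp \<alpha> * M * ((1 + cmod z) * exp (\<alpha> / 2 * (cmod z)\<^sup>2))"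
proof -
  have M: "M \<ge> 0" using order_trans[OF norm_ge_zero bound[of 0]] by simp
  have zp: "0 < 1 + cmod z" using norm_ge_zero[of z] by linarith
  define r where "r = 1 / (2 * (1 + cmod z))"
  define E where "E = exp (\<alpha> / 2 * (cmod z)\<^sup>2)"
  have r0: "r > 0" using zp by (simp add: r_def)
  have "norm ((deriv ^^ 1) F z) \<le> fact 1 * (M * exp \<alpha> * E) / r ^ 1"
  proof (rule Cauchy_inequality)
    show "F holomorphic_on ball z r" using hol holomorphic_on_subset by blast
    show "continuous_on (cball z r) F"
      using holomorphic_on_imp_continuous_on[OF hol] continuous_on_subset by blast
    fix x assume "cmod (z - x) = r"
    then have "dist z x \<le> 1 / (2 * (1 + cmod z))" by (simp add: dist_norm r_def)
    then have "(cmod x)\<^sup>2 \<le> (cmod z)\<^sup>2 + 2" by (intro norm_square_close(1)[of z z]) auto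
    then have "\<alpha> / 2 * (cmod x)\<^sup>2 \<le> \<alpha> / 2 * ((cmod z)\<^sup>2 + 2)"
      using \<alpha> by (intro mult_left_mono) auto
    also have "\<dots> = \<alpha> + \<alpha> / 2 * (cmod z)\<^sup>2" by (simp add: algebra_simps)
    finally have "exp (\<alpha> / 2 * (cmod x)\<^sup>2) \<le> exp \<alpha> * E"
      by (simp add: E_def flip: exp_add)
    then have "M * exp (\<alpha> / 2 * (cmod x)\<^sup>2) \<le> M * (exp \<alpha> * E)" using M by (rule mult_left_mono)
    then show "cmod (F x) \<le> M * exp \<alpha> * E" using bound[of x] by (simp add: mult.assoc)
  qed (fact r0)
  then show ?thesis unfolding E_def[symmetric] by (simp add: r_def algebra_simps)
qed

text \<open>Integration along the ray from 0 to z. The growth u exp(\<alpha> u^2 / 2) of the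
  derivative has the explicit primitive exp(\<alpha> u^2 / 2) / \<alpha>, so the factor 1 + |z|
  disappears.\<close>

lemma entire_gauss_bound_of_deriv:
  fixes \<alpha> M :: real
  assumes \<alpha>: "\<alpha> > 0" and hol: "F holomorphic_on UNIV"
    and bound: "\<And>z. cmod (deriv F z) \<le> M * ((1 + cmod z) * exp (\<alpha> / 2 * (cmod z)\<^sup>2))"
  shows "cmod (F z) \<le> (cmod (F 0) + (2 / \<alpha> + 2 * exp (\<alpha> / 2) * (1 + 2 / \<alpha>)) * M) * exp (\<alpha> / 2 * (cmod z)\<^sup>2)"
proof -
  have M: "M \<ge> 0" using order_trans[OF norm_ge_zero bound[of 0]] by simp
  define s where "s = cmod z"
  define E where "E = (\<lambda>t. exp (\<alpha> / 2 * (t * s)\<^sup>2))"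
  have s0: "s \<ge> 0" by (simp add: s_def)
  \<comment> \<open>Replaces 1 + u by 2 u, which can be integrated exactly, plus a constant that
    covers u < 1.\<close>
  have elem: "(1 + u) * exp (\<alpha> / 2 * u\<^sup>2) \<le> 2 * u * exp (\<alpha> / 2 * u\<^sup>2) + 2 * exp (\<alpha> / 2)"
    if "u \<ge> 0" for u :: real
  proof (cases "u \<ge> 1")
    case True
    then have "(1 + u) * exp (\<alpha> / 2 * u\<^sup>2) \<le> (2 * u) * exp (\<alpha> / 2 * u\<^sup>2)"
      by (intro mult_right_mono) auto
    then show ?thesis by (simp add: add_increasing2)
  next
    case False
    have "\<alpha> / 2 * u\<^sup>2 \<le> \<alpha> / 2 * 1\<^sup>2"
      using False that \<alpha> by (intro mult_left_mono power_mono) auto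
    then have "(1 + u) * exp (\<alpha> / 2 * u\<^sup>2) \<le> 2 * exp (\<alpha> / 2)"
      using False that by (intro mult_mono) auto
    then show ?thesis using that by (simp add: add_increasing)
  qed
  \<comment> \<open>A real majorant on [0, 1], with no relation to the symbol of the operator: its
    derivative is the right side of \<open>elem\<close> at u = t s, multiplied by
    \<open>M * s\<close>.\<close>
  define \<phi> where "\<phi> = (\<lambda>t. M * (2 / \<alpha> * E t + 2 * exp (\<alpha> / 2) * (s * t)))"
  have FF: "((\<lambda>t. F (of_real t * z)) has_vector_derivative z * deriv F (of_real t * z)) (at t)" for t
  proof -
    have "(F has_field_derivative deriv F (of_real t * z)) (at (of_real t * z))"
      using hol holomorphic_derivI open_UNIV by blast
    moreover have "((\<lambda>t. of_real t * z) has_vector_derivative 1 * z) (at t)"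
      by (intro derivative_eq_intros | simp)+
    ultimately show ?thesis
      using field_vector_diff_chain_at[of "\<lambda>t. of_real t * z" z t F] by (simp add: o_def)
  qed
  have PP: "(\<phi> has_vector_derivative M * (2 * s\<^sup>2 * t * E t + 2 * exp (\<alpha> / 2) * s)) (at t)" for t
    unfolding \<phi>_def E_def has_real_derivative_iff_has_vector_derivative[symmetric]
    using \<alpha> by (auto intro!: derivative_eq_intros simp: field_simps power2_eq_square)
  have "norm (F (of_real 1 * z) - F (of_real 0 * z)) \<le> \<phi> 1 - \<phi> 0"
  proof (rule differentiable_bound_general[where f' = "\<lambda>t. z * deriv F (of_real t * z)"
        and \<phi>' = "\<lambda>t. M * (2 * s\<^sup>2 * t * E t + 2 * exp (\<alpha> / 2) * s)"])
    show "continuous_on {0..1} (\<lambda>t. F (of_real t * z))"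
      by (intro continuous_at_imp_continuous_on ballI has_vector_derivative_continuous[OF FF])
    show "continuous_on {0..1} \<phi>"
      by (intro continuous_at_imp_continuous_on ballI has_vector_derivative_continuous[OF PP])
    fix t :: real assume t: "0 < t" "t < 1"
    show "((\<lambda>t. F (of_real t * z)) has_vector_derivative z * deriv F (of_real t * z)) (at t)" by (rule FF)
    show "(\<phi> has_vector_derivative M * (2 * s\<^sup>2 * t * E t + 2 * exp (\<alpha> / 2) * s)) (at t)" by (rule PP)
    have n: "cmod (of_real t * z) = t * s" using t by (simp add: norm_mult s_def)
    have "norm (z * deriv F (of_real t * z)) \<le> s * (M * ((1 + t * s) * exp (\<alpha> / 2 * (t * s)\<^sup>2)))"
      using bound[of "of_real t * z", unfolded n] mult_left_mono[OF _ s0]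
      unfolding norm_mult s_def[symmetric] by blast
    also have "\<dots> \<le> s * (M * (2 * (t * s) * exp (\<alpha> / 2 * (t * s)\<^sup>2) + 2 * exp (\<alpha> / 2)))"
      using t s0 M by (intro mult_left_mono elem) auto
    also have "\<dots> = M * (2 * s\<^sup>2 * t * E t + 2 * exp (\<alpha> / 2) * s)"
      by (simp add: E_def algebra_simps power2_eq_square)
    finally show "norm (z * deriv F (of_real t * z)) \<le> M * (2 * s\<^sup>2 * t * E t + 2 * exp (\<alpha> / 2) * s)" .
  qed simp
  also have "\<dots> \<le> M * (2 / \<alpha> * E 1 + 2 * exp (\<alpha> / 2) * s)"
    using M \<alpha> by (simp add: \<phi>_def E_def algebra_simps)
  also have "\<dots> \<le> M * (2 / \<alpha> * E 1 + 2 * exp (\<alpha> / 2) * ((1 + 2 / \<alpha>) * E 1))"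
  proof -
    \<comment> \<open>The linear term left by the constant in \<open>elem\<close> is absorbed into
      the Gaussian through exp x >= 1 + x.\<close>
    have "s \<le> 1 + s\<^sup>2"
    proof (cases "s \<le> 1")
      case False
      then show ?thesis using s0 by (simp add: power2_eq_square add_increasing mult_le_cancel_left1)
    qed (simp add: add_increasing2)
    also have "\<dots> \<le> (1 + 2 / \<alpha>) * (1 + \<alpha> / 2 * s\<^sup>2)"
      using \<alpha> by (simp add: field_simps)
    also have "\<dots> \<le> (1 + 2 / \<alpha>) * E 1"
      using \<alpha> exp_ge_add_one_self[of "\<alpha> / 2 * s\<^sup>2"] by (intro mult_left_mono) (auto simp: E_def)
    finally have "s \<le> (1 + 2 / \<alpha>) * E 1" .
    then show ?thesis using M by (intro mult_left_mono add_left_mono) auto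
  qed
  also have "\<dots> = ((2 / \<alpha> + 2 * exp (\<alpha> / 2) * (1 + 2 / \<alpha>)) * M) * E 1" by (simp add: algebra_simps)
  finally have "cmod (F z - F 0) \<le> ((2 / \<alpha> + 2 * exp (\<alpha> / 2) * (1 + 2 / \<alpha>)) * M) * E 1" by simp
  moreover have "cmod (F 0) \<le> cmod (F 0) * E 1" using \<alpha> by (simp add: E_def mult_le_cancel_left1)
  moreover have "cmod (F z) \<le> cmod (F 0) + cmod (F z - F 0)"
    using norm_triangle_ineq2[of "F z" "F 0"] by simp
  ultimately show ?thesis by (simp add: E_def s_def distrib_right)
qed

section \<open>Test functions of maximal growth\<close>

text \<open>The exponent is |m - m0| in truncated subtraction. The bound is the full two-sided
  geometric series, of which the part left of \<open>m0\<close> is only an initial segment; hence it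
  is uniform in \<open>m0\<close>.\<close>

lemma sum_power_dist_le:
  fixes r :: real
  assumes r: "0 \<le> r" "r < 1"
  shows "summable (\<lambda>m. r ^ (if m < m0 then m0 - m else m - m0))"
    and "(\<Sum>m. r ^ (if m < m0 then m0 - m else m - m0)) \<le> (1 + r) / (1 - r)"
proof -
  define f where "f = (\<lambda>m. r ^ (if m < m0 then m0 - m else m - m0))"
  have shift: "(\<lambda>m. f (m + m0)) = (\<lambda>m. r ^ m)" by (simp add: f_def fun_eq_iff)
  have geo: "summable (\<lambda>m. r ^ m)" "(\<Sum>m. r ^ m) = 1 / (1 - r)"
    using r by (auto simp: suminf_geometric)
  show sm: "summable (\<lambda>m. r ^ (if m < m0 then m0 - m else m - m0))"
    using geo(1) summable_iff_shift[of f m0] unfolding shift by (simp add: f_def)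
  have "(\<Sum>m. f m) = (\<Sum>m. f (m + m0)) + (\<Sum>m<m0. f m)"
    by (rule suminf_split_initial_segment) (use sm in \<open>simp add: f_def\<close>)
  also have "(\<Sum>m<m0. f m) = (\<Sum>m<m0. r * r ^ (m0 - Suc m))"
    by (intro sum.cong refl) (auto simp: f_def Suc_diff_Suc simp flip: power_Suc)
  also have "\<dots> = r * (\<Sum>m<m0. r ^ m)"
    unfolding sum_distrib_left[symmetric] by (subst sum.nat_diff_reindex) simp
  also have "\<dots> \<le> r * (1 / (1 - r))"
    using r sum_le_suminf[OF geo(1), of "{..<m0}"] unfolding geo(2) by (intro mult_left_mono) auto
  finally have "(\<Sum>m. f m) \<le> 1 / (1 - r) + r * (1 / (1 - r))" unfolding shift geo(2) by simp
  then show "(\<Sum>m. r ^ (if m < m0 then m0 - m else m - m0)) \<le> (1 + r) / (1 - r)"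
    by (simp add: f_def add_divide_distrib)
qed

text \<open>Comparison with a geometric series centred near \<open>v\<close> gives a bound uniform
  in \<open>v\<close>, also for negative \<open>v\<close>. The linear factor is there for the
  derivative of the theta series.\<close>

lemma gauss_row_bounded:
  obtains C :: real where "C > 0"
    and "\<And>v. summable (\<lambda>m. (1 + \<bar>real m - v\<bar>) * exp (- 16 * (real m - v)\<^sup>2))"
    and "\<And>v. (\<Sum>m. (1 + \<bar>real m - v\<bar>) * exp (- 16 * (real m - v)\<^sup>2)) \<le> C"
proof -
  define r where "r = exp (- 1 :: real)"
  have r: "0 \<le> r" "r < 1" by (auto simp: r_def)
  have main: "summable (\<lambda>m. (1 + \<bar>real m - v\<bar>) * exp (- 16 * (real m - v)\<^sup>2))
    \<and> (\<Sum>m. (1 + \<bar>real m - v\<bar>) * exp (- 16 * (real m - v)\<^sup>2)) \<le> exp 1 * ((1 + r) / (1 - r))" for v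
  proof -
    \<comment> \<open>The integer nearest to \<open>v\<close>, cut off at 0 by \<open>nat\<close>.
      If the cutoff acts, then \<open>v\<close> is negative and |m - v| >= m, so the distance
      estimate still holds.\<close>
    define m0 where "m0 = nat \<lfloor>v + 1 / 2\<rfloor>"
    define k where "k = (\<lambda>m. if m < m0 then m0 - m else m - m0)"
    have k: "real (k m) / 2 \<le> \<bar>real m - v\<bar>" for m
    proof -
      have fl: "of_int \<lfloor>v + 1 / 2\<rfloor> \<le> v + 1 / 2" "v + 1 / 2 < of_int \<lfloor>v + 1 / 2\<rfloor> + 1" by linarith+
      show ?thesis
      proof (cases "m < m0")
        case True
        then have "real m0 = of_int \<lfloor>v + 1 / 2\<rfloor>" by (simp add: m0_def)
        moreover have "real m + 1 \<le> real m0" using True by linarith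
        ultimately have "(real m0 - real m) / 2 \<le> v - real m" using fl(1) by (simp add: field_simps)
        then show ?thesis using True by (simp add: k_def of_nat_diff)
      next
        case False
        have "of_int \<lfloor>v + 1 / 2\<rfloor> \<le> real m0" by (simp add: m0_def)
        then have "v \<le> real m0 + 1 / 2" using fl(2) by linarith
        moreover have "m = m0 \<or> real m0 + 1 \<le> real m" using False by linarith
        ultimately show ?thesis using False by (auto simp: k_def of_nat_diff)
      qed
    qed
    have le: "(1 + \<bar>real m - v\<bar>) * exp (- 16 * (real m - v)\<^sup>2) \<le> exp 1 * r ^ k m" for m
    proof -
      define x where "x = \<bar>real m - v\<bar>"
      have x0: "x \<ge> 0" by (simp add: x_def)
      have x1: "x \<le> 1 + x\<^sup>2"
      proof (cases "x \<le> 1")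
        case False
        then show ?thesis by (simp add: power2_eq_square add_increasing mult_le_cancel_left1)
      qed (simp add: add_increasing2)
      have "(real (k m) / 2)\<^sup>2 \<le> x\<^sup>2" using k[of m] by (intro power_mono) (auto simp: x_def)
      moreover have "real (k m) \<le> (real (k m))\<^sup>2" by (cases "k m") (auto simp: power2_eq_square)
      moreover have "(real (k m) / 2)\<^sup>2 = (real (k m))\<^sup>2 / 4" by (simp add: power_divide)
      \<comment> \<open>Of the 16 in the exponent, one is spent on 1 + x <= exp x <= exp (1 + x^2);
        the remaining 15 more than cover \<open>k m\<close>, which is at most 4 x^2.\<close>
      ultimately have kx: "real (k m) \<le> 15 * x\<^sup>2" using zero_le_power2[of x] by linarith
      have "(1 + x) * exp (- 16 * x\<^sup>2) \<le> exp x * exp (- 16 * x\<^sup>2)"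
        by (intro mult_right_mono) auto
      also have "\<dots> \<le> exp 1 * exp (- real (k m))"
        using x1 kx by (simp flip: exp_add)
      also have "exp (- real (k m)) = r ^ k m" by (simp add: r_def flip: exp_of_nat_mult)
      finally show ?thesis by (simp add: x_def)
    qed
    have sm: "summable (\<lambda>m. exp 1 * r ^ k m)"
      unfolding k_def by (intro summable_mult sum_power_dist_le r)
    have s1: "summable (\<lambda>m. (1 + \<bar>real m - v\<bar>) * exp (- 16 * (real m - v)\<^sup>2))"
      by (rule summable_comparison_test'[OF sm, of 0]) (use le in \<open>auto simp: abs_mult\<close>)
    have "(\<Sum>m. (1 + \<bar>real m - v\<bar>) * exp (- 16 * (real m - v)\<^sup>2)) \<le> (\<Sum>m. exp 1 * r ^ k m)"
      by (intro suminf_le le s1 sm)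
    also have "\<dots> = exp 1 * (\<Sum>m. r ^ k m)"
      unfolding k_def by (intro suminf_mult sum_power_dist_le r)
    also have "\<dots> \<le> exp 1 * ((1 + r) / (1 - r))"
      unfolding k_def by (intro mult_left_mono sum_power_dist_le r) simp
    finally show ?thesis using s1 by blast
  qed
  moreover have "exp 1 * ((1 + r) / (1 - r)) > 0" using r by (simp add: add_pos_nonneg)
  ultimately show thesis using that by blast
qed

text \<open>This is what the constant 16 is for. At distance at most 1/4 from \<open>v\<close> the
  central term is at least exp(-1), since 16 (1/4)^2 = 1. Every other index is at distance at least
  (3/4) |m - m0|, so its term is at most exp(-9 |m - m0|), and together these amount to less than
  half of the central bound.\<close>

lemma gauss_row_dominant:
  fixes T :: "nat \<Rightarrow> complex"
  assumes T: "\<And>m. cmod (T m) = exp (- 16 * (real m - v)\<^sup>2)"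
    and m0: "\<bar>real m0 - v\<bar> \<le> 1 / 4" and sT: "summable T"
  shows "cmod (\<Sum>m. T m) \<ge> exp (- 1) / 2"
proof -
  define r where "r = exp (- 9 :: real)"
  have r: "0 \<le> r" "r < 1" by (auto simp: r_def)
  define k where "k = (\<lambda>m. if m < m0 then m0 - m else m - m0)"
  define g where "g = (\<lambda>m. r ^ k m - (if m = m0 then 1 else 0))"
  have s1: "summable (\<lambda>m. r ^ k m)" and b1: "(\<Sum>m. r ^ k m) \<le> (1 + r) / (1 - r)"
    unfolding k_def using sum_power_dist_le[OF r] by auto
  have s2: "(\<lambda>m. if m = m0 then 1 else 0 :: real) sums 1" using sums_single[of m0 "\<lambda>_. 1 :: real"] by simp
  have sg: "summable g" unfolding g_def using s1 s2 by (intro summable_diff) (auto simp: sums_iff)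
  have "(\<Sum>m. g m) = (\<Sum>m. r ^ k m) - 1"
    unfolding g_def using s1 s2 by (subst suminf_diff[symmetric]) (auto simp: sums_iff)
  also have "\<dots> \<le> (1 + r) / (1 - r) - 1" using b1 by simp
  also have "\<dots> = 2 * r / (1 - r)" using r by (simp add: field_simps)
  also have "\<dots> \<le> exp (- 1) / 2"
  proof -
    have e: "r = exp (- 1) * exp (- 8)" by (simp add: r_def flip: exp_add)
    have 9: "9 * exp (- 8 :: real) \<le> 1"
      using exp_ge_add_one_self[of "8 :: real"] by (simp add: exp_minus field_simps)
    have 10: "10 * r \<le> 1"
      using exp_ge_add_one_self[of "9 :: real"] by (simp add: r_def exp_minus field_simps)
    have "4 * exp (- 8) \<le> 1 - r" using 9 10 by simp
    then have "exp (- 1) * (4 * exp (- 8)) \<le> exp (- 1) * (1 - r)" by (intro mult_left_mono) auto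
    then have "4 * r \<le> exp (- 1) * (1 - r)" by (simp add: e)
    then show ?thesis using r by (simp add: divide_le_eq)
  qed
  finally have tail: "(\<Sum>m. g m) \<le> exp (- 1) / 2" .
  define T' where "T' = (\<lambda>m. if m = m0 then 0 else T m)"
  have le: "cmod (T' m) \<le> g m" for m
  proof (cases "m = m0")
    case False
    have k1: "k m \<ge> 1" using False by (auto simp: k_def)
    have "real (k m) = \<bar>real m - real m0\<bar>" by (auto simp: k_def of_nat_diff)
    moreover have "\<bar>real m - real m0\<bar> \<le> \<bar>real m - v\<bar> + \<bar>real m0 - v\<bar>" by arith
    ultimately have "real (k m) - 1 / 4 \<le> \<bar>real m - v\<bar>" using m0 by linarith
    then have "3 / 4 * real (k m) \<le> \<bar>real m - v\<bar>" using k1 by linarith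
    then have "(3 / 4 * real (k m))\<^sup>2 \<le> \<bar>real m - v\<bar>\<^sup>2" by (intro power_mono) auto
    moreover have "real (k m) \<le> (real (k m))\<^sup>2" by (cases "k m") (auto simp: power2_eq_square)
    moreover have "(3 / 4 * real (k m))\<^sup>2 = 9 / 16 * (real (k m))\<^sup>2" by (simp add: power2_eq_square)
    ultimately have "9 * real (k m) \<le> 16 * (real m - v)\<^sup>2" unfolding power2_abs by linarith
    then have "exp (- 16 * (real m - v)\<^sup>2) \<le> exp (real (k m) * (- 9))" by simp
    also have "\<dots> = r ^ k m" unfolding r_def by (rule exp_of_nat_mult)
    finally show ?thesis using False by (simp add: T'_def g_def T)
  qed (simp add: T'_def g_def k_def)
  have sT': "summable (\<lambda>m. cmod (T' m))"
    by (rule summable_comparison_test'[OF sg, of 0]) (use le in auto)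
  have "cmod (\<Sum>m. T' m) \<le> (\<Sum>m. g m)"
    using summable_norm[OF sT'] suminf_le[OF le sT' sg] by linarith
  then have small: "cmod (\<Sum>m. T' m) \<le> exp (- 1) / 2" using tail by linarith
  have "(\<lambda>m. (if m = m0 then T m0 else 0) + T' m) sums (T m0 + (\<Sum>m. T' m))"
    using summable_norm_cancel[OF sT'] sums_single[of m0 "\<lambda>_. T m0"]
    by (intro sums_add) (auto simp: summable_sums)
  moreover have "(\<lambda>m. (if m = m0 then T m0 else 0) + T' m) = T" by (auto simp: T'_def)
  ultimately have eq: "(\<Sum>m. T m) = T m0 + (\<Sum>m. T' m)" by (simp add: sums_iff)
  have "cmod (\<Sum>m. T m) \<ge> cmod (T m0) - exp (- 1) / 2"
    unfolding eq using small norm_diff_ineq[of "T m0" "\<Sum>m. T' m"] by linarith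
  moreover have "cmod (T m0) \<ge> exp (- 1)"
  proof -
    have "\<bar>real m0 - v\<bar>\<^sup>2 \<le> (1 / 4)\<^sup>2" by (intro power_mono m0) auto
    then show ?thesis by (simp add: T power_divide)
  qed
  ultimately show ?thesis by linarith
qed

section \<open>Half theta series and their derivatives\<close>

definition theta_coeff :: "real \<Rightarrow> nat \<Rightarrow> complex" where
  "theta_coeff s m = of_real (exp (- 16 * (real m + s)\<^sup>2))"

text \<open>One half (\<open>m \<ge> 0\<close>) of a theta series, times \<open>exp (w\<^sup>2 / 2)\<close>. The \<open>m\<close>-th term has modulus
  \<open>exp (|w|\<^sup>2 / 2 - 16 (m + s + Im w / 4)\<^sup>2)\<close>, so for \<open>Im w \<le> 0\<close> one term dominates unless \<open>- Im w / 4 - s\<close>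
  is close to a half-integer; the two shifts \<open>s = 0\<close> and \<open>s = 1/2\<close> exclude this simultaneously.\<close>

definition half_theta :: "real \<Rightarrow> complex \<Rightarrow> complex" where
  "half_theta s w = exp (w\<^sup>2 / 2 + 8 * \<i> * of_real s * w) * (\<Sum>m. theta_coeff s m * exp (8 * \<i> * w) ^ m)"

text \<open>Completing the square: with y = Im w, the real part of w^2 / 2 is |w|^2 / 2 - y^2, and
  this loss of y^2 is precisely what -16 (m + s)^2 - 8 (m + s) y needs to become -16 (m + s + y /
  4)^2.\<close>

lemma theta_term_norm:
  "cmod (exp (w\<^sup>2 / 2 + 8 * \<i> * of_real s * w) * (theta_coeff s m * exp (8 * \<i> * w) ^ m))
    = exp ((cmod w)\<^sup>2 / 2) * exp (- 16 * (real m - (- Im w / 4 - s))\<^sup>2)"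
proof -
  have "exp (w\<^sup>2 / 2 + 8 * \<i> * of_real s * w) * (theta_coeff s m * exp (8 * \<i> * w) ^ m)
      = exp (w\<^sup>2 / 2 + 8 * \<i> * of_real s * w + of_real (- 16 * (real m + s)\<^sup>2) + of_nat m * (8 * \<i> * w))"
    by (simp only: theta_coeff_def exp_add exp_of_real exp_of_nat_mult mult.assoc)
  also have "cmod \<dots> = exp ((cmod w)\<^sup>2 / 2 - 16 * (real m - (- Im w / 4 - s))\<^sup>2)"
    unfolding norm_exp_eq_Re cmod_power2 by (simp add: Re_power2 field_simps power2_eq_square)
  finally show ?thesis by (simp flip: exp_add)
qed

text \<open>For u other than 0 a logarithm writes u as exp(8 i w), and the terms become a Gaussian
  row. Convergence for every \<open>u\<close> makes the half series an entire power series in exp(8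
  i w), hence differentiable term by term.\<close>

lemma summable_theta: "summable (\<lambda>m. theta_coeff s m * u ^ m)"
proof (cases "u = 0")
  case True
  have "(\<lambda>m. theta_coeff s m * u ^ m) sums (theta_coeff s 0)"
    using sums_single[of 0 "\<lambda>_. theta_coeff s 0"] True by (simp add: power_0_left if_distrib cong: if_cong)
  then show ?thesis by (rule sums_summable)
next
  case False
  obtain C where "\<And>v. summable (\<lambda>m. (1 + \<bar>real m - v\<bar>) * exp (- 16 * (real m - v)\<^sup>2))"
    using gauss_row_bounded by blast
  note row = this
  define w where "w = - \<i> * Ln u / 8"
  have u: "exp (8 * \<i> * w) = u" using False by (simp add: w_def)
  define A where "A = exp (w\<^sup>2 / 2 + 8 * \<i> * of_real s * w)"
  define v where "v = - Im w / 4 - s"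
  have "summable (\<lambda>m. A * (theta_coeff s m * exp (8 * \<i> * w) ^ m))"
  proof (rule summable_comparison_test'[OF summable_mult[OF row[of v], of "exp ((cmod w)\<^sup>2 / 2)"], of 0])
    fix m :: nat
    have "cmod (A * (theta_coeff s m * exp (8 * \<i> * w) ^ m)) = exp ((cmod w)\<^sup>2 / 2) * (1 * exp (- 16 * (real m - v)\<^sup>2))"
      unfolding A_def v_def theta_term_norm by simp
    also have "\<dots> \<le> exp ((cmod w)\<^sup>2 / 2) * ((1 + \<bar>real m - v\<bar>) * exp (- 16 * (real m - v)\<^sup>2))"
      by (intro mult_left_mono mult_right_mono) auto
    finally show "cmod (A * (theta_coeff s m * exp (8 * \<i> * w) ^ m))
      \<le> exp ((cmod w)\<^sup>2 / 2) * ((1 + \<bar>real m - v\<bar>) * exp (- 16 * (real m - v)\<^sup>2))" .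
  qed
  from summable_mult_D[OF this] show ?thesis by (simp add: u A_def)
qed

text \<open>Up to a constant, the m-th term is exp(w^2 / 2 + 8 i (m + s) w), with logarithmic
  derivative w + 8 i (m + s). The proof applies the product and chain rules to the Gaussian factor
  and the power series in exp(8 i w).\<close>

lemma half_theta_derivative:
  "(half_theta s has_field_derivative
     (\<Sum>m. (w + 8 * \<i> * of_real (real m + s)) *
        (exp (w\<^sup>2 / 2 + 8 * \<i> * of_real s * w) * (theta_coeff s m * exp (8 * \<i> * w) ^ m)))) (at w)"
proof -
  define P where "P = (\<lambda>u. \<Sum>m. theta_coeff s m * u ^ m)"
  define P' where "P' = (\<lambda>u. \<Sum>m. diffs (theta_coeff s) m * u ^ m)"
  define A where "A = (\<lambda>w. exp (w\<^sup>2 / 2 + 8 * \<i> * of_real s * w))"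
  define u where "u = exp (8 * \<i> * w)"
  have P: "(P has_field_derivative P' u) (at u)" for u
    unfolding P_def P'_def by (rule termdiffs_strong_converges_everywhere) (rule summable_theta)
  \<comment> \<open>Multiplication by \<open>u\<close> realigns the differentiated series with the
    original one; at m = 0 the truncated exponent is harmless because the factor
    \<open>of_nat m\<close> vanishes.\<close>
  have "(\<lambda>m. of_nat m * theta_coeff s m * u ^ (m - Suc 0)) sums P' u"
    unfolding P'_def by (intro diffs_equiv termdiff_converges_all summable_theta)
  then have "(\<lambda>m. u * (of_nat m * theta_coeff s m * u ^ (m - Suc 0))) sums (u * P' u)"
    by (rule sums_mult)
  moreover have "u * (of_nat m * theta_coeff s m * u ^ (m - Suc 0)) = of_nat m * theta_coeff s m * u ^ m" for m
    by (cases m) auto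
  ultimately have uP': "(\<lambda>m. of_nat m * theta_coeff s m * u ^ m) sums (u * P' u)" by simp
  have Pu: "(\<lambda>m. theta_coeff s m * u ^ m) sums P u"
    unfolding P_def by (intro summable_sums summable_theta)
  have "(\<lambda>m. (w + 8 * \<i> * of_real s) * A w * (theta_coeff s m * u ^ m)
      + 8 * \<i> * A w * (of_nat m * theta_coeff s m * u ^ m))
     sums ((w + 8 * \<i> * of_real s) * A w * P u + 8 * \<i> * A w * (u * P' u))"
    by (intro sums_add sums_mult Pu uP')
  moreover have "(w + 8 * \<i> * of_real s) * A w * (theta_coeff s m * u ^ m)
      + 8 * \<i> * A w * (of_nat m * theta_coeff s m * u ^ m)
     = (w + 8 * \<i> * of_real (real m + s)) * (A w * (theta_coeff s m * u ^ m))" for m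
    by (simp add: algebra_simps)
  ultimately have eq: "(\<Sum>m. (w + 8 * \<i> * of_real (real m + s)) * (A w * (theta_coeff s m * u ^ m)))
     = (w + 8 * \<i> * of_real s) * A w * P u + 8 * \<i> * A w * (u * P' u)"
    by (simp add: sums_iff)
  have dA: "(A has_field_derivative (w + 8 * \<i> * of_real s) * A w) (at w)"
    unfolding A_def by (auto intro!: derivative_eq_intros simp: algebra_simps)
  have du: "((\<lambda>w. exp (8 * \<i> * w)) has_field_derivative 8 * \<i> * u) (at w)"
    unfolding u_def by (auto intro!: derivative_eq_intros)
  have "((\<lambda>w. P (exp (8 * \<i> * w))) has_field_derivative P' u * (8 * \<i> * u)) (at w)"
    by (rule DERIV_chain2[OF _ du]) (simp add: P flip: u_def)
  from DERIV_mult[OF dA this]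
  have "((\<lambda>w. A w * P (exp (8 * \<i> * w))) has_field_derivative
      (w + 8 * \<i> * of_real s) * A w * P u + 8 * \<i> * A w * (u * P' u)) (at w)"
    by (rule DERIV_cong) (simp add: u_def algebra_simps)
  moreover have "half_theta s = (\<lambda>w. A w * P (exp (8 * \<i> * w)))"
    by (simp add: half_theta_def A_def P_def fun_eq_iff)
  ultimately show ?thesis using eq by (simp add: A_def u_def)
qed

text \<open>After division by the Gaussian, the terms \<open>T\<close> form a row centred at
  \<open>v\<close>. In the derivative, w + 8 i (m + s) equals cnj w + 8 i (m - v), so the sum splits
  into cnj w times the row, bounded below by its dominant term, and a first moment about
  \<open>v\<close>, bounded uniformly by the row estimate.\<close>

lemma half_theta_bounds:
  obtains C :: real where "C > 0"
    and "\<And>s w. cmod (half_theta s w) \<le> C * exp ((cmod w)\<^sup>2 / 2)"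
    and "\<And>s w m0. \<bar>real m0 + s + Im w / 4\<bar> \<le> 1 / 4 \<Longrightarrow>
      cmod (deriv (half_theta s) w) \<ge> (exp (- 1) / 2 * cmod w - C) * exp ((cmod w)\<^sup>2 / 2)"
proof -
  obtain B where B: "B > 0"
    and row: "\<And>v. summable (\<lambda>m. (1 + \<bar>real m - v\<bar>) * exp (- 16 * (real m - v)\<^sup>2))"
    and rowB: "\<And>v. (\<Sum>m. (1 + \<bar>real m - v\<bar>) * exp (- 16 * (real m - v)\<^sup>2)) \<le> B"
    using gauss_row_bounded by blast
  have main: "cmod (half_theta s w) \<le> B * exp ((cmod w)\<^sup>2 / 2) \<and>
      (\<forall>m0. \<bar>real m0 + s + Im w / 4\<bar> \<le> 1 / 4 \<longrightarrow>
        cmod (deriv (half_theta s) w) \<ge> (exp (- 1) / 2 * cmod w - 8 * B) * exp ((cmod w)\<^sup>2 / 2))" for s w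
  proof -
    define v where "v = - Im w / 4 - s"
    define E where "E = exp ((cmod w)\<^sup>2 / 2)"
    have E0: "E > 0" by (simp add: E_def)
    define A where "A = exp (w\<^sup>2 / 2 + 8 * \<i> * of_real s * w)"
    define T where "T = (\<lambda>m. A * (theta_coeff s m * exp (8 * \<i> * w) ^ m) / of_real E)"
    have AT: "A * (theta_coeff s m * exp (8 * \<i> * w) ^ m) = of_real E * T m" for m
      using E0 by (simp add: T_def)
    have nT: "cmod (T m) = exp (- 16 * (real m - v)\<^sup>2)" for m
      using theta_term_norm[of w s m] E0 by (simp add: T_def A_def v_def E_def norm_divide)
    have sT': "summable (\<lambda>m. cmod (T m))"
      by (rule summable_comparison_test'[OF row[of v], of 0]) (simp add: nT algebra_simps)
    then have sT: "summable T" by (rule summable_norm_cancel)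
    have bT: "cmod (\<Sum>m. T m) \<le> B"
    proof -
      have "cmod (\<Sum>m. T m) \<le> (\<Sum>m. cmod (T m))" by (rule summable_norm[OF sT'])
      also have "\<dots> \<le> (\<Sum>m. (1 + \<bar>real m - v\<bar>) * exp (- 16 * (real m - v)\<^sup>2))"
        by (intro suminf_le sT' row) (simp add: nT algebra_simps)
      finally show ?thesis using rowB[of v] by linarith
    qed
    define S where "S = (\<lambda>m. of_real (real m - v) * T m)"
    have nS: "cmod (S m) \<le> (1 + \<bar>real m - v\<bar>) * exp (- 16 * (real m - v)\<^sup>2)" for m
      unfolding S_def norm_mult nT by (intro mult_right_mono) (auto simp del: of_real_diff)
    have sS': "summable (\<lambda>m. cmod (S m))"
      by (rule summable_comparison_test'[OF row[of v], of 0]) (use nS in simp)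
    then have sS: "summable S" by (rule summable_norm_cancel)
    have bS: "cmod (\<Sum>m. S m) \<le> B"
      using summable_norm[OF sS'] suminf_le[OF nS sS' row] rowB[of v] by linarith
    have ht: "half_theta s w = of_real E * (\<Sum>m. T m)"
    proof -
      have "half_theta s w = (\<Sum>m. A * (theta_coeff s m * exp (8 * \<i> * w) ^ m))"
        unfolding half_theta_def A_def by (intro suminf_mult[symmetric] summable_theta)
      then show ?thesis unfolding AT using sT by (simp add: suminf_mult)
    qed
    have 1: "cmod (half_theta s w) \<le> B * E"
      using bT E0 by (simp add: ht norm_mult mult.commute mult_left_mono)
    have d: "deriv (half_theta s) w = of_real E * (cnj w * (\<Sum>m. T m) + 8 * \<i> * (\<Sum>m. S m))"
    proof -
      have "deriv (half_theta s) w = (\<Sum>m. (w + 8 * \<i> * of_real (real m + s)) * (of_real E * T m))"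
        using DERIV_imp_deriv[OF half_theta_derivative[of s w]] unfolding A_def[symmetric] AT .
      also have "(\<lambda>m. (w + 8 * \<i> * of_real (real m + s)) * (of_real E * T m))
          = (\<lambda>m. of_real E * (cnj w * T m + 8 * \<i> * S m))"
      proof
        fix m
        \<comment> \<open>The difference w - cnj w = 2 i Im w is exactly the recentring of m + s at
          \<open>v\<close>; this produces the factor |w| of maximal growth.\<close>
        have "w + 8 * \<i> * of_real (real m + s) = cnj w + 8 * \<i> * of_real (real m - v)"
          by (simp add: complex_eq_iff v_def)
        then have "(w + 8 * \<i> * of_real (real m + s)) * (of_real E * T m)
            = (cnj w + 8 * \<i> * of_real (real m - v)) * (of_real E * T m)" by (simp only:)
        also have "\<dots> = of_real E * (cnj w * T m + 8 * \<i> * S m)"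
          by (simp add: S_def algebra_simps)
        finally show "(w + 8 * \<i> * of_real (real m + s)) * (of_real E * T m) = of_real E * (cnj w * T m + 8 * \<i> * S m)" .
      qed
      also have "(\<Sum>m. of_real E * (cnj w * T m + 8 * \<i> * S m)) = of_real E * (cnj w * (\<Sum>m. T m) + 8 * \<i> * (\<Sum>m. S m))"
        by (intro sums_unique[symmetric] sums_mult sums_add summable_sums sT sS)
      finally show ?thesis .
    qed
    have "cmod (deriv (half_theta s) w) \<ge> (exp (- 1) / 2 * cmod w - 8 * B) * E"
      if "\<bar>real m0 + s + Im w / 4\<bar> \<le> 1 / 4" for m0
    proof -
      have "real m0 - v = real m0 + s + Im w / 4" by (simp add: v_def)
      then have "\<bar>real m0 - v\<bar> \<le> 1 / 4" using that by (simp only:)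
      then have low: "cmod (\<Sum>m. T m) \<ge> exp (- 1) / 2" by (intro gauss_row_dominant[OF nT _ sT])
      have "cmod w * (exp (- 1) / 2) \<le> cmod (cnj w * (\<Sum>m. T m))"
        unfolding norm_mult complex_mod_cnj by (rule mult_left_mono[OF low]) simp
      moreover have "cmod (8 * \<i> * (\<Sum>m. S m)) \<le> 8 * B" using bS by (simp add: norm_mult)
      moreover have "cmod (cnj w * (\<Sum>m. T m)) - cmod (8 * \<i> * (\<Sum>m. S m)) \<le> cmod (cnj w * (\<Sum>m. T m) + 8 * \<i> * (\<Sum>m. S m))"
        by (rule norm_diff_ineq)
      ultimately have "exp (- 1) / 2 * cmod w - 8 * B \<le> cmod (cnj w * (\<Sum>m. T m) + 8 * \<i> * (\<Sum>m. S m))"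
        by (simp add: mult.commute)
      then show ?thesis using E0 unfolding d norm_mult by (simp add: mult.commute mult_left_mono)
    qed
    with 1 show ?thesis unfolding E_def by blast
  qed
  show thesis
  proof (rule that[of "8 * B"])
    show "cmod (half_theta s w) \<le> 8 * B * exp ((cmod w)\<^sup>2 / 2)" for s w
    proof -
      have "B * exp ((cmod w)\<^sup>2 / 2) \<le> 8 * B * exp ((cmod w)\<^sup>2 / 2)" using B by simp
      then show ?thesis using main[of s w] by linarith
    qed
  qed (use B main in auto)
qed

lemma half_theta_holomorphic: "half_theta s holomorphic_on UNIV"
  unfolding holomorphic_on_def field_differentiable_def
  using half_theta_derivative has_field_derivative_at_within by blast

section \<open>A finite set of test functions\<close>

definition gauss_bounded :: "real \<Rightarrow> (complex \<Rightarrow> complex) \<Rightarrow> bool" where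
  "gauss_bounded \<alpha> f \<longleftrightarrow> f holomorphic_on UNIV \<and> (\<exists>M. \<forall>z. cmod (f z) \<le> M * exp (\<alpha> / 2 * (cmod z)\<^sup>2))"

text \<open>Either sign of \<open>a\<close> is of use: -1 reflects the half plane, sqrt \<alpha>
  adjusts the weight.\<close>

lemma gauss_bounded_scale:
  assumes "gauss_bounded 1 f" "a\<^sup>2 = \<alpha>"
  shows "gauss_bounded \<alpha> (\<lambda>z. f (of_real a * z))"
proof -
  have f: "f holomorphic_on UNIV" using assms by (simp add: gauss_bounded_def)
  obtain M where M: "\<And>z. cmod (f z) \<le> M * exp (1 / 2 * (cmod z)\<^sup>2)"
    using assms by (auto simp: gauss_bounded_def)
  have "f \<circ> (\<lambda>z. of_real a * z) holomorphic_on UNIV"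
    by (intro holomorphic_on_compose_gen[OF _ f] holomorphic_intros) auto
  moreover have "cmod (f (of_real a * z)) \<le> M * exp (\<alpha> / 2 * (cmod z)\<^sup>2)" for z
    using M[of "of_real a * z"] assms(2) by (simp add: norm_mult power_mult_distrib)
  ultimately show ?thesis by (auto simp: gauss_bounded_def o_def)
qed

text \<open>The two shifts serve the lower half plane and their reflections the upper one. The
  identity, with derivative 1, serves a bounded disc, where the lower bound for the theta
  derivatives may be negative.\<close>

lemma gauss_test_functions_unit:
  obtains S :: "(complex \<Rightarrow> complex) set" and C :: real
  where "finite S" "C > 0" "\<And>f. f \<in> S \<Longrightarrow> gauss_bounded 1 f"
    "\<And>w. \<exists>f\<in>S. (1 + cmod w) * exp ((cmod w)\<^sup>2 / 2) \<le> C * cmod (deriv f w)"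
proof -
  obtain B where B: "B > 0"
    and up: "\<And>s w. cmod (half_theta s w) \<le> B * exp ((cmod w)\<^sup>2 / 2)"
    and low: "\<And>s w m0. \<bar>real m0 + s + Im w / 4\<bar> \<le> 1 / 4 \<Longrightarrow>
      cmod (deriv (half_theta s) w) \<ge> (exp (- 1) / 2 * cmod w - B) * exp ((cmod w)\<^sup>2 / 2)"
    using half_theta_bounds by blast
  define e where "e = exp (- 1 :: real)"
  have e: "e > 0" by (simp add: e_def)
  \<comment> \<open>Here \<open>e\<close> is exp(-1). For |w| >= 4 B / e the error \<open>B\<close>
    is at most half of e |w| / 2, and |w| >= 1 gives 1 + |w| <= 2 |w|; together they yield the
    factor \<open>D = 8 / e\<close>.\<close>
  define R where "R = max 1 (4 * B / e)"
  define D where "D = 8 / e"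
  define C where "C = max D ((1 + R) * exp (R\<^sup>2 / 2))"
  define S where "S = {half_theta 0, half_theta (1/2), \<lambda>z. half_theta 0 (- z), \<lambda>z. half_theta (1/2) (- z), \<lambda>z. z}"
  have gb: "gauss_bounded 1 (half_theta s)" for s
    using up half_theta_holomorphic by (auto simp: gauss_bounded_def)
  have gbm: "gauss_bounded 1 (\<lambda>z. half_theta s (- z))" for s
    using gauss_bounded_scale[OF gb, of "-1" 1] by simp
  have "cmod z \<le> 1 * exp (1 / 2 * (cmod z)\<^sup>2)" for z
  proof -
    have "cmod z \<le> 1 + (cmod z)\<^sup>2 / 2"
      using zero_le_power2[of "cmod z - 1"] by (simp add: power2_diff)
    also have "\<dots> \<le> exp ((cmod z)\<^sup>2 / 2)" by (rule exp_ge_add_one_self)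
    finally show ?thesis by simp
  qed
  then have gbi: "gauss_bounded 1 (\<lambda>z. z)" unfolding gauss_bounded_def by (auto intro!: exI[of _ 1])
  have dm: "deriv (\<lambda>z. half_theta s (- z)) w = - deriv (half_theta s) (- w)" for s w
  proof -
    have "(half_theta s has_field_derivative deriv (half_theta s) (- w)) (at (- w))"
      using holomorphic_derivI[OF half_theta_holomorphic] by blast
    moreover have "((\<lambda>z. - z) has_field_derivative - 1) (at w)"
      by (auto intro!: derivative_eq_intros)
    ultimately have "((\<lambda>z. half_theta s (- z)) has_field_derivative deriv (half_theta s) (- w) * - 1) (at w)"
      by (rule DERIV_chain2)
    then show ?thesis by (simp add: DERIV_imp_deriv)
  qed
  have big: "\<exists>s\<in>{0, 1/2}. (1 + cmod w) * exp ((cmod w)\<^sup>2 / 2) \<le> D * cmod (deriv (half_theta s) w)"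
    if w: "cmod w \<ge> R" and im: "Im w \<le> 0" for w
  proof -
    define t where "t = - Im w / 4"
    \<comment> \<open>The integer nearest to 2 t, nonnegative because Im w <= 0. Its parity selects
      the shift and \<open>n div 2\<close> the dominant index: their sum n / 2 is within 1/4 of
      t.\<close>
    define n where "n = nat \<lfloor>2 * t + 1 / 2\<rfloor>"
    have t0: "t \<ge> 0" using im by (simp add: t_def)
    have "real n = of_int \<lfloor>2 * t + 1 / 2\<rfloor>" using t0 by (simp add: n_def)
    then have n: "\<bar>real n - 2 * t\<bar> \<le> 1 / 2" by linarith
    define s where "s = real (n mod 2) / 2"
    have s: "s \<in> {0, 1/2}" by (cases "even n") (auto simp: s_def mod_2_eq_odd)
    have "real n = 2 * real (n div 2) + real (n mod 2)"
      by (metis mult_div_mod_eq of_nat_add of_nat_mult of_nat_numeral)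
    then have "real (n div 2) + s + Im w / 4 = (real n - 2 * t) / 2" by (simp add: s_def t_def)
    then have "\<bar>real (n div 2) + s + Im w / 4\<bar> = \<bar>real n - 2 * t\<bar> / 2" by (simp only: abs_divide abs_numeral)
    also have "\<dots> \<le> 1 / 4" using divide_right_mono[OF n, of 2] by simp
    finally have "\<bar>real (n div 2) + s + Im w / 4\<bar> \<le> 1 / 4" .
    from low[OF this] have l: "(e / 2 * cmod w - B) * exp ((cmod w)\<^sup>2 / 2) \<le> cmod (deriv (half_theta s) w)"
      by (simp add: e_def)
    have "1 \<le> cmod w" "4 * B / e \<le> cmod w" using w by (auto simp: R_def)
    then have "4 * B \<le> e * cmod w" "1 + cmod w \<le> 2 * cmod w" using e by (auto simp: divide_le_eq mult.commute)
    moreover have "e * (1 + cmod w) \<le> e * (2 * cmod w)"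
      using \<open>1 + cmod w \<le> 2 * cmod w\<close> e by (intro mult_left_mono) auto
    ultimately have "e * (1 + cmod w) \<le> 8 * (e / 2 * cmod w - B)" by simp
    then have "1 + cmod w \<le> D * (e / 2 * cmod w - B)" using e by (simp add: D_def field_simps)
    then have "(1 + cmod w) * exp ((cmod w)\<^sup>2 / 2) \<le> D * (e / 2 * cmod w - B) * exp ((cmod w)\<^sup>2 / 2)"
      by (rule mult_right_mono) simp
    also have "\<dots> \<le> D * cmod (deriv (half_theta s) w)"
      unfolding mult.assoc using e by (intro mult_left_mono l[unfolded mult.assoc]) (simp add: D_def)
    finally show ?thesis using s by blast
  qed
  have DC: "D \<le> C" by (simp add: C_def)
  show thesis
  proof (rule that[of S C])
    show "finite S" by (simp add: S_def)
    show "C > 0" by (rule less_le_trans[OF _ DC]) (use e in \<open>simp add: D_def\<close>)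
    show "gauss_bounded 1 f" if "f \<in> S" for f using that gb gbm gbi by (auto simp: S_def)
    fix w
    show "\<exists>f\<in>S. (1 + cmod w) * exp ((cmod w)\<^sup>2 / 2) \<le> C * cmod (deriv f w)"
    proof (cases "cmod w \<ge> R")
      case False
      have "(1 + cmod w) * exp ((cmod w)\<^sup>2 / 2) \<le> (1 + R) * exp (R\<^sup>2 / 2)"
        using False by (intro mult_mono) (auto simp: R_def intro!: power_mono)
      also have "\<dots> \<le> C * cmod (deriv (\<lambda>z. z) w)" by (simp add: C_def)
      finally show ?thesis unfolding S_def by blast
    next
      case True
      have mono: "D * x \<le> C * x" if "x \<ge> 0" for x using DC that by (rule mult_right_mono)
      show ?thesis
      proof (cases "Im w \<le> 0")
        case im: True
        obtain s where s: "s \<in> {0, 1/2}" "(1 + cmod w) * exp ((cmod w)\<^sup>2 / 2) \<le> D * cmod (deriv (half_theta s) w)"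
          using big[OF True im] by blast
        have "half_theta s \<in> S" using s(1) unfolding S_def by blast
        moreover have "(1 + cmod w) * exp ((cmod w)\<^sup>2 / 2) \<le> C * cmod (deriv (half_theta s) w)"
          using s(2) mono[of "cmod (deriv (half_theta s) w)"] by simp
        ultimately show ?thesis by blast
      next
        case False
        then have "R \<le> cmod (- w)" "Im (- w) \<le> 0" using True by auto
        from big[OF this] obtain s where s: "s \<in> {0, 1/2}"
          "(1 + cmod w) * exp ((cmod w)\<^sup>2 / 2) \<le> D * cmod (deriv (half_theta s) (- w))"
          unfolding norm_minus_cancel by blast
        have "(\<lambda>z. half_theta s (- z)) \<in> S" using s(1) unfolding S_def by blast
        moreover have "(1 + cmod w) * exp ((cmod w)\<^sup>2 / 2) \<le> C * cmod (deriv (\<lambda>z. half_theta s (- z)) w)"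
          using s(2) mono[of "cmod (deriv (half_theta s) (- w))"] by (simp add: dm)
        ultimately show ?thesis by blast
      qed
    qed
  qed
qed

lemma gauss_test_functions:
  fixes \<alpha> :: real
  assumes \<alpha>: "\<alpha> > 0"
  obtains S :: "(complex \<Rightarrow> complex) set" and C :: real
  where "finite S" "C > 0" "\<And>f. f \<in> S \<Longrightarrow> gauss_bounded \<alpha> f"
    "\<And>w. \<exists>f\<in>S. (1 + cmod w) * exp (\<alpha> / 2 * (cmod w)\<^sup>2) \<le> C * cmod (deriv f w)"
proof -
  obtain S C where S: "finite S" and C: "C > 0" and gb: "\<And>f. f \<in> S \<Longrightarrow> gauss_bounded 1 f"
    and low: "\<And>w. \<exists>f\<in>S. (1 + cmod w) * exp ((cmod w)\<^sup>2 / 2) \<le> C * cmod (deriv f w)"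
    using gauss_test_functions_unit by blast
  define a where "a = sqrt \<alpha>"
  have a: "a > 0" "a\<^sup>2 = \<alpha>" using \<alpha> by (auto simp: a_def)
  define S' where "S' = (\<lambda>f z. f (of_real a * z)) ` S"
  \<comment> \<open>The maximum compares 1 + |w| with 1 + a |w| after the dilation, and the division
    by \<open>a\<close> undoes the chain rule.\<close>
  define C' where "C' = max 1 (1 / a) * C / a"
  show thesis
  proof (rule that[of S' C'])
    show "finite S'" using S by (simp add: S'_def)
    show "C' > 0" using a C by (simp add: C'_def)
    show "gauss_bounded \<alpha> f" if "f \<in> S'" for f
      using that gauss_bounded_scale[OF gb a(2)] by (auto simp: S'_def)
    fix w
    obtain f where f: "f \<in> S"
      and l: "(1 + cmod (of_real a * w)) * exp ((cmod (of_real a * w))\<^sup>2 / 2) \<le> C * cmod (deriv f (of_real a * w))"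
      using low by blast
    have hol: "f holomorphic_on UNIV" using gb[OF f] by (simp add: gauss_bounded_def)
    have "(f has_field_derivative deriv f (of_real a * w)) (at (of_real a * w))"
      using holomorphic_derivI[OF hol] by blast
    moreover have "((\<lambda>z. of_real a * z) has_field_derivative of_real a) (at w)"
      by (auto intro!: derivative_eq_intros)
    ultimately have "((\<lambda>z. f (of_real a * z)) has_field_derivative deriv f (of_real a * w) * of_real a) (at w)"
      by (rule DERIV_chain2)
    then have d: "cmod (deriv (\<lambda>z. f (of_real a * z)) w) = cmod (deriv f (of_real a * w)) * a"
      using a by (simp add: DERIV_imp_deriv norm_mult)
    define k where "k = max 1 (1 / a)"
    have k1: "1 \<le> k" and "1 / a \<le> k" by (auto simp: k_def)
    then have k2: "1 \<le> k * a" using a by (simp add: divide_le_eq)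
    have "1 + cmod w \<le> k * (1 + a * cmod w)"
      using k1 mult_right_mono[OF k2, of "cmod w"] by (simp add: algebra_simps)
    then have "(1 + cmod w) * exp (\<alpha> / 2 * (cmod w)\<^sup>2) \<le> (k * (1 + a * cmod w)) * exp (\<alpha> / 2 * (cmod w)\<^sup>2)"
      by (rule mult_right_mono) simp
    also have "\<dots> = k * ((1 + cmod (of_real a * w)) * exp ((cmod (of_real a * w))\<^sup>2 / 2))"
      using a by (simp add: norm_mult power_mult_distrib)
    also have "\<dots> \<le> k * (C * cmod (deriv f (of_real a * w)))"
      using l k1 by (intro mult_left_mono) auto
    also have "\<dots> = C' * cmod (deriv (\<lambda>z. f (of_real a * z)) w)"
      using a by (simp add: d C'_def k_def)
    finally show "\<exists>f\<in>S'. (1 + cmod w) * exp (\<alpha> / 2 * (cmod w)\<^sup>2) \<le> C' * cmod (deriv f w)"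
      using f by (auto simp: S'_def)
  qed
qed

section \<open>The integral operator\<close>

text \<open>With a primitive P of f' g on the plane, the operator is P o \<phi> - P 0, and the chain
  rule applies.\<close>

lemma K_op_properties:
  assumes \<phi>: "\<phi> holomorphic_on UNIV" and g: "g holomorphic_on UNIV" and f: "f holomorphic_on UNIV"
  shows "K_op \<phi> g f holomorphic_on UNIV"
    and "deriv (K_op \<phi> g f) z = deriv f (\<phi> z) * g (\<phi> z) * deriv \<phi> z"
proof -
  have "(\<lambda>\<xi>. deriv f \<xi> * g \<xi>) holomorphic_on UNIV"
    using f g by (intro holomorphic_intros) auto
  then obtain P where P: "\<And>x. (P has_field_derivative deriv f x * g x) (at x)"
    using holomorphic_convex_primitive'[OF convex_UNIV open_UNIV] by auto
  have K: "K_op \<phi> g f = (\<lambda>z. P (\<phi> z) - P 0)"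
  proof
    fix z
    have "((\<lambda>\<xi>. deriv f \<xi> * g \<xi>) has_contour_integral
        (P (pathfinish (linepath 0 (\<phi> z))) - P (pathstart (linepath 0 (\<phi> z))))) (linepath 0 (\<phi> z))"
      by (rule contour_integral_primitive[where S = UNIV, OF _ valid_path_linepath]) (simp_all add: P)
    then show "K_op \<phi> g f z = P (\<phi> z) - P 0"
      unfolding K_op_def by (simp add: contour_integral_unique)
  qed
  have D: "(K_op \<phi> g f has_field_derivative deriv f (\<phi> z) * g (\<phi> z) * deriv \<phi> z) (at z)" for z
  proof -
    have "(\<phi> has_field_derivative deriv \<phi> z) (at z)" using holomorphic_derivI[OF \<phi>] by blast
    from DERIV_chain2[OF P this] show ?thesis unfolding K by (auto intro!: derivative_eq_intros)
  qed
  then show "K_op \<phi> g f holomorphic_on UNIV"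
    unfolding holomorphic_on_def field_differentiable_def using has_field_derivative_at_within by blast
  show "deriv (K_op \<phi> g f) z = deriv f (\<phi> z) * g (\<phi> z) * deriv \<phi> z" by (rule DERIV_imp_deriv[OF D])
qed

lemma K_op_linear:
  assumes g: "g holomorphic_on UNIV" and f: "f holomorphic_on UNIV" and h: "h holomorphic_on UNIV"
  shows "K_op \<phi> g (\<lambda>z. a * f z + b * h z) = (\<lambda>z. a * K_op \<phi> g f z + b * K_op \<phi> g h z)"
proof
  fix z
  have d: "deriv (\<lambda>z. a * f z + b * h z) \<xi> = a * deriv f \<xi> + b * deriv h \<xi>" for \<xi>
    by (rule DERIV_imp_deriv)
       (auto intro!: derivative_eq_intros holomorphic_derivI[OF f] holomorphic_derivI[OF h])
  have int: "(\<lambda>\<xi>. deriv u \<xi> * g \<xi>) contour_integrable_on (linepath 0 (\<phi> z))" if "u holomorphic_on UNIV" for u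
  proof -
    have "(\<lambda>\<xi>. deriv u \<xi> * g \<xi>) holomorphic_on UNIV"
      using that g by (intro holomorphic_intros) auto
    then have "continuous_on (closed_segment 0 (\<phi> z)) (\<lambda>\<xi>. deriv u \<xi> * g \<xi>)"
      using holomorphic_on_imp_continuous_on continuous_on_subset by blast
    then show ?thesis by (rule contour_integrable_continuous_linepath)
  qed
  have "K_op \<phi> g (\<lambda>z. a * f z + b * h z) z
      = contour_integral (linepath 0 (\<phi> z)) (\<lambda>\<xi>. a * (deriv f \<xi> * g \<xi>) + b * (deriv h \<xi> * g \<xi>))"
    unfolding K_op_def d by (simp add: algebra_simps)
  also have "\<dots> = a * K_op \<phi> g f z + b * K_op \<phi> g h z"
    unfolding K_op_def
    by (subst contour_integral_add) (simp_all add: int f h contour_integral_lmul contour_integrable_lmul)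
  finally show "K_op \<phi> g (\<lambda>z. a * f z + b * h z) z = a * K_op \<phi> g f z + b * K_op \<phi> g h z" .
qed

section \<open>Fock spaces as growth conditions and as integrals over Borel measure\<close>

lemma fock_infinity_iff: "f \<in> fock_space \<alpha> \<infinity> \<longleftrightarrow> gauss_bounded \<alpha> f"
proof -
  have e: "cmod (f z) * exp (- (\<alpha> / 2) * (cmod z)\<^sup>2) \<le> M \<longleftrightarrow> cmod (f z) \<le> M * exp (\<alpha> / 2 * (cmod z)\<^sup>2)" for z M
    by (simp add: exp_minus field_simps)
  show ?thesis
    unfolding fock_space_def gauss_bounded_def e[symmetric] by (auto simp: bdd_above_def)
qed

lemma fock_infinity_norm:
  assumes "f \<in> fock_space \<alpha> \<infinity>"
  shows "cmod (f z) \<le> fock_norm \<alpha> \<infinity> f * exp (\<alpha> / 2 * (cmod z)\<^sup>2)" "0 \<le> fock_norm \<alpha> \<infinity> f"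
proof -
  have "cmod (f z) * exp (- (\<alpha> / 2) * (cmod z)\<^sup>2) \<le> fock_norm \<alpha> \<infinity> f" for z
    using assms by (auto simp: fock_space_def fock_norm_def intro!: cSUP_upper)
  note * = this
  from *[of z] show "cmod (f z) \<le> fock_norm \<alpha> \<infinity> f * exp (\<alpha> / 2 * (cmod z)\<^sup>2)"
    by (simp add: exp_minus field_simps)
  show "0 \<le> fock_norm \<alpha> \<infinity> f" using order_trans[OF _ *[of 0]] by simp
qed

lemma fock_infinity_norm_le:
  assumes "\<And>z. cmod (f z) \<le> M * exp (\<alpha> / 2 * (cmod z)\<^sup>2)"
  shows "fock_norm \<alpha> \<infinity> f \<le> M"
proof -
  have "cmod (f z) * exp (- (\<alpha> / 2) * (cmod z)\<^sup>2) \<le> M" for z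
    using assms[of z] by (simp add: exp_minus field_simps)
  then show ?thesis by (auto simp: fock_norm_def intro!: cSUP_least)
qed

text \<open>An entire function is Borel, so completing the measure changes nothing. The second
  equation also holds for a divergent integral, where both sides take the default value 0.\<close>

lemma fock_finite_iff:
  fixes q :: ennreal
  assumes q: "q \<noteq> \<infinity>" "q > 0" and f: "f holomorphic_on UNIV"
  shows "f \<in> fock_space \<alpha> q \<longleftrightarrow>
    (\<integral>\<^sup>+z. ennreal (cmod (f z) powr enn2real q * exp (- (\<alpha> * enn2real q / 2) * (cmod z)\<^sup>2)) \<partial>lborel) < \<infinity>"
    and "(LINT z|lebesgue. cmod (f z) powr enn2real q * exp (- (\<alpha> * enn2real q / 2) * (cmod z)\<^sup>2))
     = enn2real (\<integral>\<^sup>+z. ennreal (cmod (f z) powr enn2real q * exp (- (\<alpha> * enn2real q / 2) * (cmod z)\<^sup>2)) \<partial>lborel)"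
proof -
  have [measurable]: "f \<in> borel_measurable borel"
    by (intro borel_measurable_continuous_onI holomorphic_on_imp_continuous_on f)
  define u where "u = (\<lambda>z. cmod (f z) powr enn2real q * exp (- (\<alpha> * enn2real q / 2) * (cmod z)\<^sup>2))"
  have u: "u \<in> borel_measurable borel" unfolding u_def by measurable
  have u0: "u z \<ge> 0" for z by (simp add: u_def)
  have int: "integrable lebesgue u \<longleftrightarrow> integrable lborel u"
    using u by (intro integrable_completion) simp
  show "f \<in> fock_space \<alpha> q \<longleftrightarrow>
    (\<integral>\<^sup>+z. ennreal (cmod (f z) powr enn2real q * exp (- (\<alpha> * enn2real q / 2) * (cmod z)\<^sup>2)) \<partial>lborel) < \<infinity>"
  proof -
    have "f \<in> fock_space \<alpha> q \<longleftrightarrow> integrable lborel u"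
      using q f unfolding int[symmetric] by (simp add: fock_space_def u_def)
    also have "\<dots> \<longleftrightarrow> (\<integral>\<^sup>+z. ennreal (u z) \<partial>lborel) < \<infinity>"
      using u u0 by (simp add: integrable_iff_bounded)
    finally show ?thesis by (simp only: u_def)
  qed
  have "(LINT z|lebesgue. u z) = (LINT z|lborel. u z)"
    using u by (intro integral_completion) simp
  also have "\<dots> = enn2real (\<integral>\<^sup>+z. ennreal (u z) \<partial>lborel)"
    using u u0 by (intro integral_eq_nn_integral) auto
  finally show "(LINT z|lebesgue. cmod (f z) powr enn2real q * exp (- (\<alpha> * enn2real q / 2) * (cmod z)\<^sup>2))
     = enn2real (\<integral>\<^sup>+z. ennreal (cmod (f z) powr enn2real q * exp (- (\<alpha> * enn2real q / 2) * (cmod z)\<^sup>2)) \<partial>lborel)"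
    unfolding u_def .
qed

section \<open>The symbol as the transfer factor between f' and the derivative of its image\<close>

definition K_symbol :: "real \<Rightarrow> (complex \<Rightarrow> complex) \<Rightarrow> (complex \<Rightarrow> complex) \<Rightarrow> complex \<Rightarrow> real" where
  "K_symbol \<alpha> \<phi> g z = (1 + cmod (\<phi> z)) / (1 + cmod z) * cmod (g (\<phi> z) * deriv \<phi> z)
         * exp (\<alpha> / 2 * ((cmod (\<phi> z))\<^sup>2 - (cmod z)\<^sup>2))"

lemma K_symbol_nonneg: "K_symbol \<alpha> \<phi> g z \<ge> 0"
  by (simp add: K_symbol_def add_nonneg_nonneg)

lemma continuous_on_K_symbol:
  assumes \<phi>: "\<phi> holomorphic_on UNIV" and g: "g holomorphic_on UNIV"
  shows "continuous_on UNIV (K_symbol \<alpha> \<phi> g)"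
proof -
  have c\<phi>: "continuous_on UNIV \<phi>" and cg: "continuous_on UNIV g"
    using \<phi> g holomorphic_on_imp_continuous_on by auto
  have cd: "continuous_on UNIV (deriv \<phi>)"
    using \<phi> by (intro holomorphic_on_imp_continuous_on holomorphic_deriv) auto
  have cg\<phi>: "continuous_on UNIV (\<lambda>z. g (\<phi> z))" by (rule continuous_on_compose2[OF cg c\<phi>]) simp
  have nz: "1 + cmod z \<noteq> 0" for z using norm_ge_zero[of z] by linarith
  show ?thesis unfolding K_symbol_def by (intro continuous_intros c\<phi> cg\<phi> cd ballI nz)
qed

lemma K_op_deriv_le_symbol:
  assumes \<phi>: "\<phi> holomorphic_on UNIV" and g: "g holomorphic_on UNIV" and f: "f holomorphic_on UNIV"
    and bound: "\<And>w. cmod (deriv f w) \<le> M * ((1 + cmod w) * exp (\<alpha> / 2 * (cmod w)\<^sup>2))"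
  shows "cmod (deriv (K_op \<phi> g f) z) \<le> M * K_symbol \<alpha> \<phi> g z * ((1 + cmod z) * exp (\<alpha> / 2 * (cmod z)\<^sup>2))"
proof -
  have zp: "1 + cmod z \<noteq> 0" using norm_ge_zero[of z] by linarith
  have "cmod (deriv (K_op \<phi> g f) z) = cmod (deriv f (\<phi> z)) * cmod (g (\<phi> z) * deriv \<phi> z)"
    by (simp add: K_op_properties(2)[OF \<phi> g f] norm_mult)
  also have "\<dots> \<le> M * ((1 + cmod (\<phi> z)) * exp (\<alpha> / 2 * (cmod (\<phi> z))\<^sup>2)) * cmod (g (\<phi> z) * deriv \<phi> z)"
    by (intro mult_right_mono bound) simp
  also have "\<dots> = M * K_symbol \<alpha> \<phi> g z * ((1 + cmod z) * exp (\<alpha> / 2 * (cmod z)\<^sup>2))"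
    using zp by (simp add: K_symbol_def right_diff_distrib exp_diff)
  finally show ?thesis .
qed

text \<open>The lower bound on f' is assumed at the single point \<open>\<phi> z\<close>, because
  the test function that satisfies it changes with z.\<close>

lemma K_symbol_le_K_op_deriv:
  assumes \<phi>: "\<phi> holomorphic_on UNIV" and g: "g holomorphic_on UNIV" and f: "f holomorphic_on UNIV"
    and bound: "(1 + cmod (\<phi> z)) * exp (\<alpha> / 2 * (cmod (\<phi> z))\<^sup>2) \<le> C * cmod (deriv f (\<phi> z))"
  shows "K_symbol \<alpha> \<phi> g z \<le> C * (cmod (deriv (K_op \<phi> g f) z) / (1 + cmod z) * exp (- (\<alpha> / 2) * (cmod z)\<^sup>2))"
proof -
  define X where "X = cmod (g (\<phi> z) * deriv \<phi> z) / (1 + cmod z) * exp (- (\<alpha> / 2) * (cmod z)\<^sup>2)"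
  have X: "X \<ge> 0" by (simp add: X_def add_nonneg_nonneg)
  have "K_symbol \<alpha> \<phi> g z = (1 + cmod (\<phi> z)) * exp (\<alpha> / 2 * (cmod (\<phi> z))\<^sup>2) * X"
  proof -
    have "exp (\<alpha> / 2 * ((cmod (\<phi> z))\<^sup>2 - (cmod z)\<^sup>2))
        = exp (\<alpha> / 2 * (cmod (\<phi> z))\<^sup>2) * exp (- (\<alpha> / 2) * (cmod z)\<^sup>2)"
      by (simp add: algebra_simps flip: exp_add)
    then show ?thesis by (simp only: K_symbol_def X_def) simp
  qed
  also have "\<dots> \<le> C * cmod (deriv f (\<phi> z)) * X" by (intro mult_right_mono bound X)
  also have "\<dots> = C * (cmod (deriv (K_op \<phi> g f) z) / (1 + cmod z) * exp (- (\<alpha> / 2) * (cmod z)\<^sup>2))"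
    by (simp add: K_op_properties(2)[OF \<phi> g f] norm_mult X_def)
  finally show ?thesis .
qed

text \<open>Controls the value at 0 that remains when F is estimated by F'. It is an integral over
  the segment from 0 to \<open>\<phi> 0\<close>, a compact set on which \<open>g\<close> and the
  growth factor are bounded.\<close>

lemma K_op_zero_bound:
  assumes \<alpha>: "\<alpha> > 0" and g: "g holomorphic_on UNIV"
  obtains C where "C \<ge> 0"
    "\<And>f M. f holomorphic_on UNIV \<Longrightarrow> (\<And>w. cmod (deriv f w) \<le> M * ((1 + cmod w) * exp (\<alpha> / 2 * (cmod w)\<^sup>2)))
      \<Longrightarrow> cmod (K_op \<phi> g f 0) \<le> C * M"
proof -
  define S where "S = closed_segment 0 (\<phi> 0)"
  have "continuous_on S g"
    using holomorphic_on_imp_continuous_on[OF g] continuous_on_subset by blast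
  then have "continuous_on S (\<lambda>w. (1 + cmod w) * exp (\<alpha> / 2 * (cmod w)\<^sup>2) * cmod (g w))"
    by (intro continuous_intros)
  then obtain x where x: "x \<in> S"
    and max: "\<And>w. w \<in> S \<Longrightarrow> (1 + cmod w) * exp (\<alpha> / 2 * (cmod w)\<^sup>2) * cmod (g w)
        \<le> (1 + cmod x) * exp (\<alpha> / 2 * (cmod x)\<^sup>2) * cmod (g x)"
    using continuous_attains_sup[of S] compact_segment[of 0 "\<phi> 0"] ends_in_segment(1)[of 0 "\<phi> 0"]
    unfolding S_def by blast
  define B where "B = (1 + cmod x) * exp (\<alpha> / 2 * (cmod x)\<^sup>2) * cmod (g x)"
  have B: "B \<ge> 0" by (simp add: B_def add_nonneg_nonneg)
  show thesis
  proof (rule that[of "B * cmod (\<phi> 0)"])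
    show "0 \<le> B * cmod (\<phi> 0)" using B by simp
    fix f M
    assume f: "f holomorphic_on UNIV"
      and bound: "\<And>w. cmod (deriv f w) \<le> M * ((1 + cmod w) * exp (\<alpha> / 2 * (cmod w)\<^sup>2))"
    have M: "M \<ge> 0" using order_trans[OF norm_ge_zero bound[of 0]] by simp
    have "(\<lambda>\<xi>. deriv f \<xi> * g \<xi>) holomorphic_on UNIV"
      using f g by (intro holomorphic_intros) auto
    then have "(\<lambda>\<xi>. deriv f \<xi> * g \<xi>) contour_integrable_on (linepath 0 (\<phi> 0))"
      using holomorphic_on_imp_continuous_on continuous_on_subset
      by (intro contour_integrable_continuous_linepath) blast
    then have "cmod (K_op \<phi> g f 0) \<le> (B * M) * cmod (\<phi> 0 - 0)"
      unfolding K_op_def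
    proof (rule contour_integral_bound_linepath)
      fix w assume "w \<in> closed_segment 0 (\<phi> 0)"
      then have w: "w \<in> S" by (simp add: S_def)
      have "cmod (deriv f w * g w) \<le> M * ((1 + cmod w) * exp (\<alpha> / 2 * (cmod w)\<^sup>2)) * cmod (g w)"
        unfolding norm_mult by (intro mult_right_mono bound) simp
      also have "\<dots> \<le> M * B" using mult_left_mono[OF max[OF w] M] by (simp add: B_def mult_ac)
      finally show "cmod (deriv f w * g w) \<le> B * M" by (simp add: mult.commute)
    qed (use B M in simp)
    then show "cmod (K_op \<phi> g f 0) \<le> B * cmod (\<phi> 0) * M" by (simp add: mult_ac)
  qed
qed

section \<open>The boundedness criterion\<close>

lemma bounded_fock_infinity_iff:
  assumes \<phi>: "\<phi> holomorphic_on UNIV" and g: "g holomorphic_on UNIV" and \<alpha>: "\<alpha> > 0"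
  shows "bounded_fock_operator \<alpha> \<infinity> \<infinity> (K_op \<phi> g) \<longleftrightarrow> K_symbol \<alpha> \<phi> g \<in> Lq \<infinity> lebesgue"
proof
  assume L: "bounded_fock_operator \<alpha> \<infinity> \<infinity> (K_op \<phi> g)"
  obtain S C where S: "finite S" "C > 0" "\<And>f. f \<in> S \<Longrightarrow> gauss_bounded \<alpha> f"
    and low: "\<And>w. \<exists>f\<in>S. (1 + cmod w) * exp (\<alpha> / 2 * (cmod w)\<^sup>2) \<le> C * cmod (deriv f w)"
    using gauss_test_functions[OF \<alpha>] by blast
  have "\<exists>M. \<forall>f\<in>S. \<forall>z. cmod (K_op \<phi> g f z) \<le> M * exp (\<alpha> / 2 * (cmod z)\<^sup>2)"
  proof -
    have "\<forall>f\<in>S. \<exists>M. \<forall>z. cmod (K_op \<phi> g f z) \<le> M * exp (\<alpha> / 2 * (cmod z)\<^sup>2)"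
    proof
      fix f assume "f \<in> S"
      then have "f \<in> fock_space \<alpha> \<infinity>" using S(3) fock_infinity_iff by blast
      then have "K_op \<phi> g f \<in> fock_space \<alpha> \<infinity>" using L unfolding bounded_fock_operator_def by blast
      then show "\<exists>M. \<forall>z. cmod (K_op \<phi> g f z) \<le> M * exp (\<alpha> / 2 * (cmod z)\<^sup>2)"
        unfolding fock_infinity_iff gauss_bounded_def by blast
    qed
    then obtain m where m: "\<And>f z. f \<in> S \<Longrightarrow> cmod (K_op \<phi> g f z) \<le> m f * exp (\<alpha> / 2 * (cmod z)\<^sup>2)"
      by metis
    have "cmod (K_op \<phi> g f z) \<le> Max (m ` S) * exp (\<alpha> / 2 * (cmod z)\<^sup>2)" if f: "f \<in> S" for f z
    proof -
      have "m f * exp (\<alpha> / 2 * (cmod z)\<^sup>2) \<le> Max (m ` S) * exp (\<alpha> / 2 * (cmod z)\<^sup>2)"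
        using S(1) f by (intro mult_right_mono Max_ge) auto
      then show ?thesis using m[OF f, of z] by linarith
    qed
    then show ?thesis by blast
  qed
  then obtain M where M: "\<And>f z. f \<in> S \<Longrightarrow> cmod (K_op \<phi> g f z) \<le> M * exp (\<alpha> / 2 * (cmod z)\<^sup>2)"
    by blast
  have "K_symbol \<alpha> \<phi> g z \<le> C * (2 * exp \<alpha> * M)" for z
  proof -
    obtain f where f: "f \<in> S" and l: "(1 + cmod (\<phi> z)) * exp (\<alpha> / 2 * (cmod (\<phi> z))\<^sup>2) \<le> C * cmod (deriv f (\<phi> z))"
      using low by blast
    have hf: "f holomorphic_on UNIV" using S(3)[OF f] by (simp add: gauss_bounded_def)
    have zp: "0 < 1 + cmod z" using norm_ge_zero[of z] by linarith
    have "cmod (deriv (K_op \<phi> g f) z) \<le> 2 * exp \<alpha> * M * ((1 + cmod z) * exp (\<alpha> / 2 * (cmod z)\<^sup>2))"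
      using \<alpha> by (intro entire_gauss_bound_deriv K_op_properties[OF \<phi> g hf] M f) simp
    then have "cmod (deriv (K_op \<phi> g f) z) / (1 + cmod z) * exp (- (\<alpha> / 2) * (cmod z)\<^sup>2) \<le> 2 * exp \<alpha> * M"
      using zp by (simp add: exp_minus divide_le_eq mult_ac flip: divide_inverse)
    then have "C * (cmod (deriv (K_op \<phi> g f) z) / (1 + cmod z) * exp (- (\<alpha> / 2) * (cmod z)\<^sup>2)) \<le> C * (2 * exp \<alpha> * M)"
      using S(2) by (intro mult_left_mono) auto
    then show ?thesis using K_symbol_le_K_op_deriv[OF \<phi> g hf l] by linarith
  qed
  then have "\<exists>C. AE z in lebesgue. \<bar>K_symbol \<alpha> \<phi> g z\<bar> \<le> C"
    using K_symbol_nonneg by (intro exI[of _ "C * (2 * exp \<alpha> * M)"] AE_I2) simp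
  moreover have "K_symbol \<alpha> \<phi> g \<in> borel_measurable lebesgue"
    by (intro measurable_completion borel_measurable_continuous_onI) (simp add: borel_measurable_continuous_onI continuous_on_K_symbol[OF \<phi> g])
  ultimately show "K_symbol \<alpha> \<phi> g \<in> Lq \<infinity> lebesgue" by (simp add: Lq_def)
next
  assume "K_symbol \<alpha> \<phi> g \<in> Lq \<infinity> lebesgue"
  then obtain B where "AE z in lebesgue. \<bar>K_symbol \<alpha> \<phi> g z\<bar> \<le> B" by (auto simp: Lq_def)
  then have AE: "AE z in lebesgue. z \<in> {z. K_symbol \<alpha> \<phi> g z \<le> B}" by eventually_elim simp
  \<comment> \<open>Continuity upgrades the essential bound to a bound everywhere: a closed set of
    full measure is the whole plane.\<close>
  have "closed {z. K_symbol \<alpha> \<phi> g z \<le> B}"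
    by (intro closed_Collect_le continuous_on_K_symbol[OF \<phi> g] continuous_on_const)
  from mem_closed_if_AE_lebesgue[OF this AE] have B: "K_symbol \<alpha> \<phi> g z \<le> B" for z by blast
  obtain C0 where C0: "C0 \<ge> 0" and at0: "\<And>f M. f holomorphic_on UNIV \<Longrightarrow>
      (\<And>w. cmod (deriv f w) \<le> M * ((1 + cmod w) * exp (\<alpha> / 2 * (cmod w)\<^sup>2))) \<Longrightarrow> cmod (K_op \<phi> g f 0) \<le> C0 * M"
    using K_op_zero_bound[OF \<alpha> g] by blast
  define D where "D = 2 / \<alpha> + 2 * exp (\<alpha> / 2) * (1 + 2 / \<alpha>)"
  have D: "D \<ge> 0" using \<alpha> by (simp add: D_def add_nonneg_nonneg)
  \<comment> \<open>\<open>2 * exp \<alpha>\<close> passes from the norm of f to f',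
    \<open>C0\<close> bounds the value at 0, and \<open>D * B\<close> integrates the derivative of
    the image.\<close>
  define C where "C = (C0 + D * B) * (2 * exp \<alpha>)"
  have bd: "cmod (K_op \<phi> g f z) \<le> (C * fock_norm \<alpha> \<infinity> f) * exp (\<alpha> / 2 * (cmod z)\<^sup>2)"
    if f: "f \<in> fock_space \<alpha> \<infinity>" for f z
  proof -
    have hf: "f holomorphic_on UNIV" using f by (simp add: fock_space_def)
    define M where "M = 2 * exp \<alpha> * fock_norm \<alpha> \<infinity> f"
    have M: "M \<ge> 0" using fock_infinity_norm(2)[OF f] by (simp add: M_def)
    have df: "cmod (deriv f w) \<le> M * ((1 + cmod w) * exp (\<alpha> / 2 * (cmod w)\<^sup>2))" for w
      unfolding M_def using \<alpha> by (intro entire_gauss_bound_deriv fock_infinity_norm hf f) simp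
    have "cmod (deriv (K_op \<phi> g f) w) \<le> (M * B) * ((1 + cmod w) * exp (\<alpha> / 2 * (cmod w)\<^sup>2))" for w
    proof -
      have "M * K_symbol \<alpha> \<phi> g w * ((1 + cmod w) * exp (\<alpha> / 2 * (cmod w)\<^sup>2))
          \<le> (M * B) * ((1 + cmod w) * exp (\<alpha> / 2 * (cmod w)\<^sup>2))"
        by (intro mult_right_mono mult_left_mono B M) (simp add: add_nonneg_nonneg)
      then show ?thesis using K_op_deriv_le_symbol[OF \<phi> g hf df, of w] by linarith
    qed
    from entire_gauss_bound_of_deriv[OF \<alpha> K_op_properties(1)[OF \<phi> g hf] this, of z]
    have "cmod (K_op \<phi> g f z) \<le> (cmod (K_op \<phi> g f 0) + D * (M * B)) * exp (\<alpha> / 2 * (cmod z)\<^sup>2)"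
      by (simp add: D_def)
    also have "\<dots> \<le> (C0 * M + D * (M * B)) * exp (\<alpha> / 2 * (cmod z)\<^sup>2)"
      by (intro mult_right_mono add_right_mono at0 hf df) simp
    also have "\<dots> = (C * fock_norm \<alpha> \<infinity> f) * exp (\<alpha> / 2 * (cmod z)\<^sup>2)"
      by (simp add: C_def M_def algebra_simps)
    finally show ?thesis .
  qed
  have "K_op \<phi> g f \<in> fock_space \<alpha> \<infinity>" if f: "f \<in> fock_space \<alpha> \<infinity>" for f
    using bd[OF f] K_op_properties(1)[OF \<phi> g] f
    unfolding fock_infinity_iff gauss_bounded_def by blast
  moreover have "fock_norm \<alpha> \<infinity> (K_op \<phi> g f) \<le> C * fock_norm \<alpha> \<infinity> f" if f: "f \<in> fock_space \<alpha> \<infinity>" for f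
    by (intro fock_infinity_norm_le bd f)
  moreover have "K_op \<phi> g (\<lambda>z. a * f z + b * h z) = (\<lambda>z. a * K_op \<phi> g f z + b * K_op \<phi> g h z)"
    if "f \<in> fock_space \<alpha> \<infinity>" "h \<in> fock_space \<alpha> \<infinity>" for f h a b
    using that by (intro K_op_linear g) (auto simp: fock_space_def)
  ultimately show "bounded_fock_operator \<alpha> \<infinity> \<infinity> (K_op \<phi> g)"
    unfolding bounded_fock_operator_def by blast
qed

lemma K_symbol_Lq_iff:
  assumes \<phi>: "\<phi> holomorphic_on UNIV" and g: "g holomorphic_on UNIV" and q: "q \<noteq> \<infinity>"
  shows "K_symbol \<alpha> \<phi> g \<in> Lq q lebesgue \<longleftrightarrow>
    (\<integral>\<^sup>+z. ennreal (K_symbol \<alpha> \<phi> g z powr enn2real q) \<partial>lborel) < \<infinity>"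
proof -
  have [measurable]: "K_symbol \<alpha> \<phi> g \<in> borel_measurable borel"
    by (intro borel_measurable_continuous_onI continuous_on_K_symbol \<phi> g)
  have "integrable lebesgue (\<lambda>z. K_symbol \<alpha> \<phi> g z powr enn2real q)
      \<longleftrightarrow> integrable lborel (\<lambda>z. K_symbol \<alpha> \<phi> g z powr enn2real q)"
    by (rule integrable_completion) measurable
  moreover have "K_symbol \<alpha> \<phi> g \<in> borel_measurable lebesgue" by (intro measurable_completion) simp
  ultimately show ?thesis
    using q K_symbol_nonneg[of \<alpha> \<phi> g] by (simp add: Lq_def integrable_iff_bounded)
qed

lemma powr_gauss_weight:
  fixes x q \<alpha> y :: real
  shows "(x * exp (- (\<alpha> / 2) * y)) powr q = x powr q * exp (- (\<alpha> * q / 2) * y)"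
proof -
  have "exp (- (\<alpha> / 2) * y) powr q = exp (- (\<alpha> * q / 2) * y)"
    unfolding exp_powr_real by (simp add: mult_ac)
  then show ?thesis by (simp only: powr_mult)
qed

lemma bounded_fock_finite_iff:
  fixes q :: ennreal
  assumes \<phi>: "\<phi> holomorphic_on UNIV" and g: "g holomorphic_on UNIV" and \<alpha>: "\<alpha> > 0"
    and q: "q \<noteq> \<infinity>" "q > 0"
  shows "bounded_fock_operator \<alpha> \<infinity> q (K_op \<phi> g) \<longleftrightarrow> K_symbol \<alpha> \<phi> g \<in> Lq q lebesgue"
proof
  define p where "p = enn2real q"
  have p: "p > 0" using q by (simp add: p_def enn2real_positive_iff less_top)
  define c where "c = \<alpha> * p / 2"
  have c: "c > 0" using p \<alpha> by (simp add: c_def)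
  \<comment> \<open>Up to a constant factor, \<open>I\<close> is the p-th power of the Fock norm,
    and \<open>J\<close> is its counterpart for |F'| / (1 + |z|). Values in \<open>ennreal\<close>
    allow finiteness to be concluded rather than assumed.\<close>
  define I where "I = (\<lambda>F. \<integral>\<^sup>+z. ennreal (cmod (F z) powr p * exp (- c * (cmod z)\<^sup>2)) \<partial>lborel)"
  define J where "J = (\<lambda>F. \<integral>\<^sup>+z. ennreal ((cmod (deriv F z) / (1 + cmod z)) powr p * exp (- c * (cmod z)\<^sup>2)) \<partial>lborel)"
  have space: "F \<in> fock_space \<alpha> q \<longleftrightarrow> I F < \<infinity>" if "F holomorphic_on UNIV" for F
    using fock_finite_iff(1)[OF q that, of \<alpha>] by (simp add: I_def c_def p_def)
  have norm: "fock_norm \<alpha> q F = (\<alpha> * p / (2 * pi) * enn2real (I F)) powr (1 / p)" if "F holomorphic_on UNIV" for F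
    using q fock_finite_iff(2)[OF q that, of \<alpha>] by (simp add: fock_norm_def I_def c_def p_def)
  have symb: "K_symbol \<alpha> \<phi> g \<in> Lq q lebesgue \<longleftrightarrow> (\<integral>\<^sup>+z. ennreal (K_symbol \<alpha> \<phi> g z powr p) \<partial>lborel) < \<infinity>"
    unfolding p_def by (rule K_symbol_Lq_iff[OF \<phi> g q(1)])
  have fp: "cmod (deriv F z) / (1 + cmod z) \<ge> 0" for F z by (simp add: add_nonneg_nonneg)
  have wt: "(cmod (deriv F z) / (1 + cmod z) * exp (- (\<alpha> / 2) * (cmod z)\<^sup>2)) powr p
      = (cmod (deriv F z) / (1 + cmod z)) powr p * exp (- c * (cmod z)\<^sup>2)" for F z
    unfolding powr_gauss_weight by (simp only: c_def)

  show "K_symbol \<alpha> \<phi> g \<in> Lq q lebesgue" if L: "bounded_fock_operator \<alpha> \<infinity> q (K_op \<phi> g)"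
  proof -
    obtain S C where S: "finite S" "C > 0" "\<And>f. f \<in> S \<Longrightarrow> gauss_bounded \<alpha> f"
      and low: "\<And>w. \<exists>f\<in>S. (1 + cmod w) * exp (\<alpha> / 2 * (cmod w)\<^sup>2) \<le> C * cmod (deriv f w)"
      using gauss_test_functions[OF \<alpha>] by blast
    obtain D where "D > 0" and D: "\<And>F. F holomorphic_on UNIV \<Longrightarrow> J F \<le> ennreal D * I F"
      using nn_integral_gauss_deriv_le[OF p less_imp_le[OF c]] unfolding I_def J_def by blast
    have hS: "K_op \<phi> g f holomorphic_on UNIV" "f holomorphic_on UNIV" if "f \<in> S" for f
      using S(3)[OF that] K_op_properties(1)[OF \<phi> g] by (auto simp: gauss_bounded_def)
    have fin: "J (K_op \<phi> g f) < \<infinity>" if f: "f \<in> S" for f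
    proof -
      have "K_op \<phi> g f \<in> fock_space \<alpha> q"
        using L S(3)[OF f] fock_infinity_iff[of f \<alpha>] unfolding bounded_fock_operator_def by blast
      then have "ennreal D * I (K_op \<phi> g f) < \<infinity>"
        using space hS[OF f] by (simp add: ennreal_mult_less_top)
      then show ?thesis using D[OF hS(1)[OF f]] by (rule le_less_trans[rotated])
    qed
    define u where "u = (\<lambda>f z. ennreal ((cmod (deriv (K_op \<phi> g f) z) / (1 + cmod z)) powr p * exp (- c * (cmod z)\<^sup>2)))"
    have mu: "u f \<in> borel_measurable borel" if "f \<in> S" for f
    proof -
      have "deriv (K_op \<phi> g f) holomorphic_on UNIV" using hS[OF that] by (intro holomorphic_deriv) auto
      then have [measurable]: "deriv (K_op \<phi> g f) \<in> borel_measurable borel"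
        by (intro borel_measurable_continuous_onI holomorphic_on_imp_continuous_on)
      show ?thesis unfolding u_def by measurable
    qed
    have "(\<integral>\<^sup>+z. ennreal (K_symbol \<alpha> \<phi> g z powr p) \<partial>lborel) \<le> (\<integral>\<^sup>+z. (\<Sum>f\<in>S. ennreal (C powr p) * u f z) \<partial>lborel)"
    proof (rule nn_integral_mono)
      fix z
      \<comment> \<open>The choice of \<open>f\<close> at each \<open>z\<close> need not be
        measurable; it is dominated by the sum over all of \<open>S\<close>.\<close>
      obtain f where f: "f \<in> S" and l: "(1 + cmod (\<phi> z)) * exp (\<alpha> / 2 * (cmod (\<phi> z))\<^sup>2) \<le> C * cmod (deriv f (\<phi> z))"
        using low by blast
      have "K_symbol \<alpha> \<phi> g z powr p
          \<le> (C * (cmod (deriv (K_op \<phi> g f) z) / (1 + cmod z) * exp (- (\<alpha> / 2) * (cmod z)\<^sup>2))) powr p"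
        using p K_symbol_nonneg K_symbol_le_K_op_deriv[OF \<phi> g hS(2)[OF f] l] by (intro powr_mono2) auto
      also have "\<dots> = C powr p * ((cmod (deriv (K_op \<phi> g f) z) / (1 + cmod z)) powr p * exp (- c * (cmod z)\<^sup>2))"
        unfolding wt[symmetric] by (rule powr_mult)
      finally have "ennreal (K_symbol \<alpha> \<phi> g z powr p) \<le> ennreal (C powr p) * u f z"
        by (simp add: u_def ennreal_leI flip: ennreal_mult')
      also have "\<dots> \<le> (\<Sum>f\<in>S. ennreal (C powr p) * u f z)"
        using S(1) f by (intro member_le_sum) auto
      finally show "ennreal (K_symbol \<alpha> \<phi> g z powr p) \<le> (\<Sum>f\<in>S. ennreal (C powr p) * u f z)" .
    qed
    also have "\<dots> = (\<Sum>f\<in>S. ennreal (C powr p) * J (K_op \<phi> g f))"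
      using mu by (simp add: nn_integral_sum nn_integral_cmult J_def u_def)
    also have "\<dots> < \<infinity>" using S(1) fin by (simp add: ennreal_mult_less_top)
    finally show ?thesis using symb by blast
  qed

  show "bounded_fock_operator \<alpha> \<infinity> q (K_op \<phi> g)" if L: "K_symbol \<alpha> \<phi> g \<in> Lq q lebesgue"
  proof -
    obtain h where h: "(\<integral>\<^sup>+z. ennreal (K_symbol \<alpha> \<phi> g z powr p) \<partial>lborel) = ennreal h" "h \<ge> 0"
      using L symb by (metis ennreal_cases infinity_ennreal_def less_irrefl)
    have [measurable]: "K_symbol \<alpha> \<phi> g \<in> borel_measurable borel"
      by (intro borel_measurable_continuous_onI continuous_on_K_symbol \<phi> g)
    obtain C0 where C0: "C0 \<ge> 0" and at0: "\<And>f M. f holomorphic_on UNIV \<Longrightarrow>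
        (\<And>w. cmod (deriv f w) \<le> M * ((1 + cmod w) * exp (\<alpha> / 2 * (cmod w)\<^sup>2))) \<Longrightarrow> cmod (K_op \<phi> g f 0) \<le> C0 * M"
      using K_op_zero_bound[OF \<alpha> g] by blast
    obtain D where D0: "D > 0" and D: "\<And>F. F holomorphic_on UNIV \<Longrightarrow> I F \<le> ennreal D * (ennreal (cmod (F 0) powr p) + J F)"
      using nn_integral_gauss_le_deriv[OF p c] unfolding I_def J_def by blast
    \<comment> \<open>\<open>D\<close> is the constant of the estimate by the derivative,
      \<open>C0 powr p\<close> accounts for the value at 0, \<open>h\<close> is the integral of the
      symbol, and the last factor comes from the pointwise bound on f'.\<close>
    define B where "B = D * (C0 powr p + h) * (2 * exp \<alpha>) powr p"
    have B: "B \<ge> 0" using D0 h(2) by (simp add: B_def)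
    have main: "I (K_op \<phi> g f) \<le> ennreal (B * fock_norm \<alpha> \<infinity> f powr p)" if f: "f \<in> fock_space \<alpha> \<infinity>" for f
    proof -
      have hf: "f holomorphic_on UNIV" using f by (simp add: fock_space_def)
      define M where "M = 2 * exp \<alpha> * fock_norm \<alpha> \<infinity> f"
      have n0: "fock_norm \<alpha> \<infinity> f \<ge> 0" by (rule fock_infinity_norm(2)[OF f])
      then have M: "M \<ge> 0" by (simp add: M_def)
      have df: "cmod (deriv f w) \<le> M * ((1 + cmod w) * exp (\<alpha> / 2 * (cmod w)\<^sup>2))" for w
        unfolding M_def using \<alpha> by (intro entire_gauss_bound_deriv fock_infinity_norm hf f) simp
      have "J (K_op \<phi> g f) \<le> (\<integral>\<^sup>+z. ennreal (M powr p) * ennreal (K_symbol \<alpha> \<phi> g z powr p) \<partial>lborel)"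
        unfolding J_def
      proof (rule nn_integral_mono)
        fix z
        have zp: "0 < 1 + cmod z" using norm_ge_zero[of z] by linarith
        have "cmod (deriv (K_op \<phi> g f) z) / (1 + cmod z) * exp (- (\<alpha> / 2) * (cmod z)\<^sup>2) \<le> M * K_symbol \<alpha> \<phi> g z"
          using K_op_deriv_le_symbol[OF \<phi> g hf df, of z] zp
          by (simp add: exp_minus divide_le_eq mult_ac flip: divide_inverse)
        then have "(cmod (deriv (K_op \<phi> g f) z) / (1 + cmod z) * exp (- (\<alpha> / 2) * (cmod z)\<^sup>2)) powr p \<le> (M * K_symbol \<alpha> \<phi> g z) powr p"
          using p fp by (intro powr_mono2) auto
        then show "ennreal ((cmod (deriv (K_op \<phi> g f) z) / (1 + cmod z)) powr p * exp (- c * (cmod z)\<^sup>2))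
            \<le> ennreal (M powr p) * ennreal (K_symbol \<alpha> \<phi> g z powr p)"
          unfolding wt using M K_symbol_nonneg by (simp add: powr_mult ennreal_leI flip: ennreal_mult')
      qed
      also have "\<dots> = ennreal (M powr p) * ennreal h" by (simp add: nn_integral_cmult h)
      finally have J: "J (K_op \<phi> g f) \<le> ennreal (M powr p * h)" using h(2) by (simp add: ennreal_mult')
      have "cmod (K_op \<phi> g f 0) powr p \<le> (C0 * M) powr p"
        using p by (intro powr_mono2 at0 hf df) auto
      then have K0: "cmod (K_op \<phi> g f 0) powr p \<le> C0 powr p * M powr p"
        using C0 M by (simp add: powr_mult)
      have "I (K_op \<phi> g f) \<le> ennreal D * (ennreal (C0 powr p * M powr p) + ennreal (M powr p * h))"
        by (intro order_trans[OF D[OF K_op_properties(1)[OF \<phi> g hf]]] mult_left_mono add_mono J ennreal_leI K0) simp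
      also have "\<dots> = ennreal (D * (C0 powr p * M powr p + M powr p * h))"
        using D0 h(2) by (simp add: ennreal_mult')
      also have "D * (C0 powr p * M powr p + M powr p * h) = B * fock_norm \<alpha> \<infinity> f powr p"
        using n0 by (simp add: B_def M_def powr_mult algebra_simps)
      finally show ?thesis .
    qed
    have "K_op \<phi> g f \<in> fock_space \<alpha> q" if f: "f \<in> fock_space \<alpha> \<infinity>" for f
    proof -
      have "K_op \<phi> g f holomorphic_on UNIV"
        using f by (intro K_op_properties[OF \<phi> g]) (simp add: fock_space_def)
      then show ?thesis using le_less_trans[OF main[OF f]] by (simp add: space)
    qed
    \<comment> \<open>The integral bound is homogeneous of degree p in the norm of f, so the p-th
      root is a linear bound, for p < 1 as well.\<close>
    moreover have "fock_norm \<alpha> q (K_op \<phi> g f) \<le> (\<alpha> * p / (2 * pi) * B) powr (1 / p) * fock_norm \<alpha> \<infinity> f"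
      if f: "f \<in> fock_space \<alpha> \<infinity>" for f
    proof -
      have n0: "fock_norm \<alpha> \<infinity> f \<ge> 0" by (rule fock_infinity_norm(2)[OF f])
      have hol: "K_op \<phi> g f holomorphic_on UNIV"
        using f by (intro K_op_properties[OF \<phi> g]) (simp add: fock_space_def)
      have "enn2real (I (K_op \<phi> g f)) \<le> B * fock_norm \<alpha> \<infinity> f powr p"
        using enn2real_mono[OF main[OF f]] B by simp
      then have "(\<alpha> * p / (2 * pi) * enn2real (I (K_op \<phi> g f))) powr (1 / p)
          \<le> (\<alpha> * p / (2 * pi) * (B * fock_norm \<alpha> \<infinity> f powr p)) powr (1 / p)"
        using p \<alpha> by (intro powr_mono2 mult_left_mono) auto
      also have "\<dots> = (\<alpha> * p / (2 * pi) * B) powr (1 / p) * (fock_norm \<alpha> \<infinity> f powr p) powr (1 / p)"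
        using p \<alpha> B by (subst powr_mult[symmetric]) (auto simp: mult.assoc)
      also have "(fock_norm \<alpha> \<infinity> f powr p) powr (1 / p) = fock_norm \<alpha> \<infinity> f"
        using p n0 by (simp add: powr_powr)
      finally show ?thesis by (simp add: norm[OF hol])
    qed
    moreover have "K_op \<phi> g (\<lambda>z. a * f z + b * h z) = (\<lambda>z. a * K_op \<phi> g f z + b * K_op \<phi> g h z)"
      if "f \<in> fock_space \<alpha> \<infinity>" "h \<in> fock_space \<alpha> \<infinity>" for f h a b
      using that by (intro K_op_linear g) (auto simp: fock_space_def)
    ultimately show ?thesis unfolding bounded_fock_operator_def by blast
  qed
qed

theorem corollary4p6:
  fixes \<phi> g :: "complex \<Rightarrow> complex" and \<alpha> :: real and q :: ennreal
  assumes "\<phi> holomorphic_on UNIV"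
    and "g holomorphic_on UNIV"
    and "\<alpha> > 0"
    and "0 < q"
  shows "bounded_fock_operator \<alpha> \<infinity> q (K_op \<phi> g) \<longleftrightarrow>
    (\<lambda>z. (1 + cmod (\<phi> z)) / (1 + cmod z) * cmod (g (\<phi> z) * deriv \<phi> z)
         * exp (\<alpha> / 2 * ((cmod (\<phi> z))\<^sup>2 - (cmod z)\<^sup>2))) \<in> Lq q lebesgue"
proof -
  have "(\<lambda>z. (1 + cmod (\<phi> z)) / (1 + cmod z) * cmod (g (\<phi> z) * deriv \<phi> z)
         * exp (\<alpha> / 2 * ((cmod (\<phi> z))\<^sup>2 - (cmod z)\<^sup>2))) = K_symbol \<alpha> \<phi> g"
    by (rule ext) (simp only: K_symbol_def)
  then show ?thesis
    using bounded_fock_infinity_iff[OF assms(1-3)] bounded_fock_finite_iff[OF assms(1-3) _ assms(4)]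
    by (cases "q = \<infinity>") simp_all
qed

end
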